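(* Let $(\Sigma,\tau)$ be a subshift without isolated periodic points whose complexity $\rho$ satisfies $$\lim_{n\to\infty}\left(\frac{\log n}{n}\right)^2\rho(n)=0.$$ Then the topological full group $[[\tau]]$ is amenable.
   Context: Let $\mathcal{A}$ be a finite alphabet and give $\mathcal{A}^{\mathbb{Z}}$ the product topology. The shift $\tau$ acts by $(\tau x)_i=x_{i+1}$. A subshift $(\Sigma,\tau)$ is a closed shift-invariant subset $\Sigma\subset\mathcal{A}^{\mathbb{Z}}$ with the restriction of $\tau$. "Without isolated periodic points" means that no $\tau$-periodic point of $\Sigma$ is isolated in $\Sigma$. The complexity $\rho(n)$ is the number of words of length $n$ over $\mathcal{A}$ that appear as sub-words of sequences in $\Sigma$. The topological full group $[[\tau]]$ is the group of homeomorphisms $g$ of $\Sigma$ such that there is a continuous function $k_g:\Sigma\to\mathbb{Z}$ with $g(x)=\tau^{k_g(x)}(x)$ for all $x\in\Sigma$. Amenability is as a discrete group. *)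

theory Defs
  imports "HOL-Analysis.Analysis" "HOL-Algebra.Bij" "HOL-Algebra.Coset"
begin

section \<open>Subshifts\<close>

definition shift :: "(int \<Rightarrow> 'a) \<Rightarrow> int \<Rightarrow> 'a"
  where "shift x = (\<lambda>i. x (i + 1))"

definition shift_power :: "int \<Rightarrow> (int \<Rightarrow> 'a) \<Rightarrow> int \<Rightarrow> 'a"
  where "shift_power k =
    (if k \<ge> 0 then shift ^^ nat k else inv_into UNIV shift ^^ nat (- k))"

definition full_shift :: "'a set \<Rightarrow> (int \<Rightarrow> 'a) topology"
  where "full_shift A = product_topology (\<lambda>_. discrete_topology A) UNIV"

definition subshift_topology :: "'a set \<Rightarrow> (int \<Rightarrow> 'a) set \<Rightarrow> (int \<Rightarrow> 'a) topology"
  where "subshift_topology A X = subtopology (full_shift A) X"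

definition subshift :: "'a set \<Rightarrow> (int \<Rightarrow> 'a) set \<Rightarrow> bool"
  where "subshift A X \<longleftrightarrow> finite A \<and> closedin (full_shift A) X \<and> shift ` X = X"

definition periodic_point :: "(int \<Rightarrow> 'a) \<Rightarrow> bool"
  where "periodic_point x \<longleftrightarrow> (\<exists>p::nat. p > 0 \<and> (shift ^^ p) x = x)"

text \<open>Isolated means isolated in the subshift, not in the full shift.\<close>

definition without_isolated_periodic_points :: "'a set \<Rightarrow> (int \<Rightarrow> 'a) set \<Rightarrow> bool"
  where "without_isolated_periodic_points A X \<longleftrightarrow>
    \<not> (\<exists>x\<in>X. periodic_point x \<and> openin (subshift_topology A X) {x})"

definition subshift_words :: "(int \<Rightarrow> 'a) set \<Rightarrow> nat \<Rightarrow> 'a list set"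
  where "subshift_words X n =
    {w. length w = n \<and> (\<exists>x\<in>X. \<exists>i::int. \<forall>j<n. w ! j = x (i + int j))}"

definition complexity :: "(int \<Rightarrow> 'a) set \<Rightarrow> nat \<Rightarrow> nat"
  where "complexity X n = card (subshift_words X n)"


section \<open>The topological full group\<close>

text \<open>
  As in \<^const>\<open>BijGroup\<close>, a self-map of \<open>X\<close> is represented by its unique extension
  that is \<^const>\<open>undefined\<close> outside \<open>X\<close>.
\<close>

definition full_group_elements ::
    "'a set \<Rightarrow> (int \<Rightarrow> 'a) set \<Rightarrow> ((int \<Rightarrow> 'a) \<Rightarrow> int \<Rightarrow> 'a) set"
  where "full_group_elements A X =
    {g \<in> Bij X.
       homeomorphic_map (subshift_topology A X) (subshift_topology A X) g \<and>
       (\<exists>k :: (int \<Rightarrow> 'a) \<Rightarrow> int.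
          continuous_map (subshift_topology A X) (discrete_topology UNIV) k \<and>
          (\<forall>x\<in>X. g x = shift_power (k x) x))}"

definition topological_full_group ::
    "'a set \<Rightarrow> (int \<Rightarrow> 'a) set \<Rightarrow> ((int \<Rightarrow> 'a) \<Rightarrow> int \<Rightarrow> 'a) monoid"
  where "topological_full_group A X =
    (BijGroup X) \<lparr>carrier := full_group_elements A X\<rparr>"


section \<open>Amenability of discrete groups\<close>

text \<open>A left-invariant, finitely additive probability measure on all subsets of the group.\<close>

definition left_invariant_mean :: "('a, 'b) monoid_scheme \<Rightarrow> ('a set \<Rightarrow> real) \<Rightarrow> bool"
  where "left_invariant_mean G \<mu> \<longleftrightarrow>
    (\<forall>S. S \<subseteq> carrier G \<longrightarrow> 0 \<le> \<mu> S) \<and>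
    \<mu> (carrier G) = 1 \<and>
    (\<forall>S T. S \<subseteq> carrier G \<longrightarrow> T \<subseteq> carrier G \<longrightarrow> S \<inter> T = {} \<longrightarrow> \<mu> (S \<union> T) = \<mu> S + \<mu> T) \<and>
    (\<forall>g\<in>carrier G. \<forall>S. S \<subseteq> carrier G \<longrightarrow> \<mu> (g <#\<^bsub>G\<^esub> S) = \<mu> S)"

definition amenable_group :: "('a, 'b) monoid_scheme \<Rightarrow> bool"
  where "amenable_group G \<longleftrightarrow> group G \<and> (\<exists>\<mu>. left_invariant_mean G \<mu>)"


section \<open>Basic facts\<close>

lemma inv_shift: "inv_into UNIV shift x = (\<lambda>i. x (i - 1))"
proof (rule inv_f_eq)
  show "inj (shift :: (int \<Rightarrow> 'a) \<Rightarrow> _)"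
  proof (rule injI)
    fix x y :: "int \<Rightarrow> 'a" assume "shift x = shift y"
    then have "x (i - 1 + 1) = y (i - 1 + 1)" for i
      unfolding shift_def by meson
    then show "x = y" by auto
  qed
qed (simp add: shift_def)

lemma shift_funpow: "(shift ^^ n) x = (\<lambda>i. x (i + int n))"
  by (induction n) (auto simp: shift_def algebra_simps)

lemma inv_shift_funpow: "(inv_into UNIV shift ^^ n) x = (\<lambda>i. x (i - int n))"
  by (induction n) (auto simp: inv_shift algebra_simps)

lemma shift_power_apply: "shift_power k x = (\<lambda>i. x (i + k))"
  by (auto simp: shift_power_def shift_funpow inv_shift_funpow)

lemma shift_power_add: "shift_power (k + l) x = shift_power k (shift_power l x)"
  by (simp add: shift_power_apply algebra_simps)

lemma topspace_full_shift: "topspace (full_shift A) = {x. \<forall>i. x i \<in> A}"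
  by (auto simp: full_shift_def PiE_def extensional_def Pi_def)

lemma topspace_subshift_topology:
  "subshift A X \<Longrightarrow> topspace (subshift_topology A X) = X"
  using closedin_subset by (fastforce simp: subshift_def subshift_topology_def)

lemma finite_subshift_words:
  assumes "subshift A X"
  shows "finite (subshift_words X n)"
proof (rule finite_subset)
  show "finite {w. set w \<subseteq> A \<and> length w = n}"
    using assms finite_lists_length_eq by (auto simp: subshift_def)
  have "x i \<in> A" if "x \<in> X" for x i
    using assms that closedin_subset[of "full_shift A" X]
    by (auto simp: subshift_def topspace_full_shift)
  then show "subshift_words X n \<subseteq> {w. set w \<subseteq> A \<and> length w = n}"
    by (auto simp: subshift_words_def in_set_conv_nth)
qed

lemma subgroup_full_group_elements:
  assumes "subshift A X"
  shows "subgroup (full_group_elements A X) (BijGroup X)"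
proof (rule group.subgroupI[OF group_BijGroup])
  let ?T = "subshift_topology A X"
  let ?E = "full_group_elements A X"
  have top: "topspace ?T = X"
    using topspace_subshift_topology[OF assms] .
  show "?E \<subseteq> carrier (BijGroup X)"
    by (auto simp: full_group_elements_def BijGroup_def)
  have "(\<lambda>x\<in>X. x) \<in> ?E"
    unfolding full_group_elements_def
  proof (intro CollectI conjI exI[where x = "\<lambda>_. 0"])
    show "homeomorphic_map ?T ?T (\<lambda>x\<in>X. x)"
      using homeomorphic_map_eq[of ?T ?T id "\<lambda>x\<in>X. x"] by (simp add: top)
  qed (auto simp: id_Bij shift_power_apply)
  then show "?E \<noteq> {}" by blast
next
  let ?T = "subshift_topology A X"
  let ?E = "full_group_elements A X"
  have top: "topspace ?T = X"
    using topspace_subshift_topology[OF assms] .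
  fix g assume "g \<in> ?E"
  then obtain k where g: "g \<in> Bij X" and hg: "homeomorphic_map ?T ?T g"
    and ck: "continuous_map ?T (discrete_topology UNIV) k"
    and k: "\<And>x. x \<in> X \<Longrightarrow> g x = shift_power (k x) x"
    by (auto simp: full_group_elements_def)
  obtain h where h: "homeomorphic_maps ?T ?T g h"
    using hg homeomorphic_map_maps by blast
  have bij: "bij_betw g X X" using g by (simp add: Bij_def)
  have hX: "h x \<in> X" "g (h x) = x" if "x \<in> X" for x
    using h that top by (auto simp: homeomorphic_maps_def continuous_map_def Pi_iff)
  have inv: "inv_into X g x = h x" if "x \<in> X" for x
    using hX[OF that] bij by (metis bij_betw_def inv_into_f_f)
  have "(\<lambda>x\<in>X. inv_into X g x) \<in> ?E"
    unfolding full_group_elements_def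
  proof (intro CollectI conjI exI[where x = "\<lambda>x. - k (h x)"] ballI)
    show "homeomorphic_map ?T ?T (\<lambda>x\<in>X. inv_into X g x)"
      using h homeomorphic_map_eq[of ?T ?T h "\<lambda>x\<in>X. inv_into X g x"] inv top
      by (simp add: homeomorphic_map_maps) (metis homeomorphic_maps_sym homeomorphic_map_maps)
    have "continuous_map ?T ?T h"
      using h by (simp add: homeomorphic_maps_def)
    then have "continuous_map ?T (discrete_topology UNIV) ((\<lambda>n. - n) \<circ> (k \<circ> h))"
      by (intro continuous_map_compose[of _ "discrete_topology UNIV"]
            continuous_map_compose[OF _ ck]) auto
    then show "continuous_map ?T (discrete_topology UNIV) (\<lambda>x. - k (h x))"
      by (simp add: o_def)
    fix x assume x: "x \<in> X"
    have "shift_power (- k (h x)) (g (h x)) = h x"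
      using k[OF hX(1)[OF x]] by (simp add: shift_power_apply)
    then show "(\<lambda>x\<in>X. inv_into X g x) x = shift_power (- k (h x)) x"
      using x hX inv by simp
  qed (use g in \<open>rule restrict_inv_into_Bij\<close>)
  then show "inv\<^bsub>BijGroup X\<^esub> g \<in> ?E"
    by (simp add: inv_BijGroup[OF g])
  fix f assume "f \<in> ?E"
  then obtain l where f: "f \<in> Bij X" and hf: "homeomorphic_map ?T ?T f"
    and cl: "continuous_map ?T (discrete_topology UNIV) l"
    and l: "\<And>x. x \<in> X \<Longrightarrow> f x = shift_power (l x) x"
    by (auto simp: full_group_elements_def)
  have "compose X g f \<in> ?E"
    unfolding full_group_elements_def
  proof (intro CollectI conjI exI[where x = "\<lambda>x. k (f x) + l x"] ballI)
    show "compose X g f \<in> Bij X" using compose_Bij g f by blast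
    show "homeomorphic_map ?T ?T (compose X g f)"
      using homeomorphic_map_eq[OF homeomorphic_map_compose[OF hf hg], of "compose X g f"] top
      by (simp add: compose_def)
    have "continuous_map ?T (discrete_topology UNIV) (k \<circ> f)"
      using continuous_map_compose[OF homeomorphic_imp_continuous_map[OF hf] ck] .
    then have "continuous_map ?T (prod_topology (discrete_topology UNIV) (discrete_topology UNIV))
        (\<lambda>x. (k (f x), l x))"
      using cl by (simp add: continuous_map_pairwise o_def)
    then have "continuous_map ?T (discrete_topology UNIV) ((\<lambda>(m, n). m + n) \<circ> (\<lambda>x. (k (f x), l x)))"
      by (rule continuous_map_compose) (simp flip: prod_topology_discrete_topology)
    then show "continuous_map ?T (discrete_topology UNIV) (\<lambda>x. k (f x) + l x)"
      by (simp add: o_def)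
    fix x assume x: "x \<in> X"
    then have "f x \<in> X" using f Bij_imp_funcset by blast
    then show "compose X g f x = shift_power (k (f x) + l x) x"
      using x k l by (simp add: compose_def shift_power_add)
  qed
  then show "g \<otimes>\<^bsub>BijGroup X\<^esub> f \<in> ?E"
    using g f by (simp add: BijGroup_def)
qed

lemma group_topological_full_group:
  "subshift A X \<Longrightarrow> group (topological_full_group A X)"
  unfolding topological_full_group_def
  by (intro subgroup.subgroup_is_group subgroup_full_group_elements group_BijGroup)

end

theory Submission
  imports Defs "HOL-Real_Asymp.Real_Asymp"
begin

text \<open>
  The return probabilities of random walks on the full group do not decay exponentially; this is
  shown by following the entropy argument of Matte Bon. Fix a finite symmetric set \<open>K\<close> in the
  group and run the lazy random walk on it for \<open>n\<close> steps.

  On the orbit of an aperiodic point, identified with \<open>\<int>\<close>, each element of \<open>K\<close> acts by bounded moves,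
  and the walk induced there is symmetric. It therefore has Gaussian tails
  (\<open>lazy_walk_tail\<close>), and up to probability at most \<open>n ^ (- c)\<close> it stays within distance
  \<open>R = C * sqrt (n * ln n)\<close> for all \<open>n\<close> steps. While it does, it only depends on a window of about
  \<open>2 * R\<close> coordinates of the starting point. The number of windows is polynomial in \<open>n\<close>, so with
  probability at least one half the walk is confined for one aperiodic representative of each window
  simultaneously. Such representatives exist because aperiodic points are dense
  (\<open>aperiodic_points_dense\<close>), which is what the absence of isolated periodic points is for.

  In this event the group element reached at time \<open>n\<close> is determined by one integer in \<open>{- R..R}\<close> for
  each window (\<open>few_word_products_with_confined_orbits\<close>), so it lies in a set of at most
  \<open>(2 * R + 1) ^ \<rho> (2 * R + O(1))\<close> elements. The hypothesis on the complexity is just what makes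
  this number \<open>exp (o(n))\<close> (\<open>time_and_radius_exist\<close>).

  A distribution with half of its mass on \<open>exp (o(n))\<close> elements has square norm at least
  \<open>exp (- o(n))\<close>, so along some step the norm hardly decreases, and convexity makes the square of the
  distribution before that step almost invariant under \<open>K\<close>
  (\<open>almost_invariant_if_word_products_concentrate\<close>). A compactness argument
  (\<open>amenable_if_almost_invariant\<close>) turns such almost invariant measures into an invariant mean.
\<close>

section \<open>From almost invariant measures to an invariant mean\<close>

definition finitely_additive_prob :: "'g set \<Rightarrow> ('g set \<Rightarrow> real) \<Rightarrow> bool"
  where "finitely_additive_prob C \<mu> \<longleftrightarrow>
    (\<forall>S. 0 \<le> \<mu> S \<and> \<mu> S \<le> 1) \<and> \<mu> C = 1 \<and>
    (\<forall>S T. S \<subseteq> C \<longrightarrow> T \<subseteq> C \<longrightarrow> S \<inter> T = {} \<longrightarrow> \<mu> (S \<union> T) = \<mu> S + \<mu> T)"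

definition almost_invariant :: "('g, 'b) monoid_scheme \<Rightarrow> 'g \<Rightarrow> real \<Rightarrow> ('g set \<Rightarrow> real) \<Rightarrow> bool"
  where "almost_invariant G g \<epsilon> \<mu> \<longleftrightarrow>
    (\<forall>S. S \<subseteq> carrier G \<longrightarrow> \<bar>\<mu> (g <#\<^bsub>G\<^esub> S) - \<mu> S\<bar> \<le> \<epsilon>)"

text \<open>
  Set functions are points of a cube with one coordinate in \<open>{0..1}\<close> per subset, which is compact by
  Tychonoff; additivity and almost invariance only involve finitely many coordinates at a time, so
  they cut out closed sets. Total functions on all subsets, bounded everywhere, are used so that the
  cube is a product over a whole type.
\<close>

lemma compact_finitely_additive_prob:
  "compact {\<mu> :: 'g set \<Rightarrow> real. finitely_additive_prob C \<mu>}"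
proof -
  let ?cube = "PiE UNIV (\<lambda>_. {0..1}) :: ('g set \<Rightarrow> real) set"
  have "compactin (product_topology (\<lambda>_. euclidean) UNIV) ?cube"
    by (subst compactin_PiE) auto
  then have "compact ?cube"
    by (simp add: euclidean_product_topology)
  moreover have "closed {\<mu> :: 'g set \<Rightarrow> real. \<mu> C = 1 \<and>
    (\<forall>S T. S \<subseteq> C \<longrightarrow> T \<subseteq> C \<longrightarrow> S \<inter> T = {} \<longrightarrow> \<mu> (S \<union> T) = \<mu> S + \<mu> T)}"
    by (intro closed_Collect_conj closed_Collect_all closed_Collect_imp closed_Collect_eq
        continuous_intros open_Collect_const continuous_on_product_coordinates)
  ultimately have "compact (?cube \<inter> {\<mu> :: 'g set \<Rightarrow> real. \<mu> C = 1 \<and>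
    (\<forall>S T. S \<subseteq> C \<longrightarrow> T \<subseteq> C \<longrightarrow> S \<inter> T = {} \<longrightarrow> \<mu> (S \<union> T) = \<mu> S + \<mu> T)})"
    by (rule compact_Int_closed)
  also have "?cube \<inter> {\<mu> :: 'g set \<Rightarrow> real. \<mu> C = 1 \<and>
    (\<forall>S T. S \<subseteq> C \<longrightarrow> T \<subseteq> C \<longrightarrow> S \<inter> T = {} \<longrightarrow> \<mu> (S \<union> T) = \<mu> S + \<mu> T)}
    = {\<mu>. finitely_additive_prob C \<mu>}"
    by (auto simp: finitely_additive_prob_def PiE_def Pi_def)
  finally show ?thesis .
qed

lemma closed_almost_invariant: "closed {\<mu>. almost_invariant G g \<epsilon> \<mu>}"
  unfolding almost_invariant_def
  by (intro closed_Collect_all closed_Collect_imp closed_Collect_le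
      continuous_intros open_Collect_const continuous_on_product_coordinates)

text \<open>
  Almost invariance under one element with one tolerance is a closed condition, and the hypothesis
  says that any finitely many of these conditions have a common solution; by compactness all of them
  do, and a solution of all of them is invariant.
\<close>

lemma amenable_if_almost_invariant:
  fixes G :: "('g, 'b) monoid_scheme"
  assumes "group G"
    and almost: "\<And>K \<epsilon>. finite K \<Longrightarrow> K \<subseteq> carrier G \<Longrightarrow> \<epsilon> > 0 \<Longrightarrow>
      \<exists>\<mu>. finitely_additive_prob (carrier G) \<mu> \<and> (\<forall>g\<in>K. almost_invariant G g \<epsilon> \<mu>)"
  shows "amenable_group G"
proof -
  interpret group G by fact
  let ?M = "{\<mu>. finitely_additive_prob (carrier G) \<mu>}"
  define T where "T = (\<lambda>(g, \<epsilon>). {\<mu>. almost_invariant G g \<epsilon> \<mu>})"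
  define I where "I = carrier G \<times> {0::real<..}"
  have "?M \<inter> \<Inter> (T ` I) \<noteq> {}"
  proof (rule compact_imp_fip[OF compact_finitely_additive_prob])
    show "closed S" if "S \<in> T ` I" for S
      using that closed_almost_invariant by (auto simp: T_def)
    fix \<F> assume "finite \<F>" "\<F> \<subseteq> T ` I"
    then obtain J where J: "J \<subseteq> I" "finite J" "\<F> = T ` J"
      by (meson finite_subset_image)
    define \<epsilon> where "\<epsilon> = Min (insert 1 (snd ` J))"
    have "\<epsilon> > 0" using J by (auto simp: \<epsilon>_def I_def)
    moreover have "finite (fst ` J)" "fst ` J \<subseteq> carrier G"
      using J by (auto simp: I_def)
    ultimately obtain \<mu> where \<mu>: "\<mu> \<in> ?M" "\<forall>g\<in>fst ` J. almost_invariant G g \<epsilon> \<mu>"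
      using almost by (metis mem_Collect_eq)
    have "\<mu> \<in> T j" if "j \<in> J" for j
    proof -
      have "\<epsilon> \<le> snd j" using that J by (auto simp: \<epsilon>_def intro!: Min_le)
      moreover have "almost_invariant G (fst j) \<epsilon> \<mu>" using \<mu>(2) that by blast
      ultimately have "almost_invariant G (fst j) (snd j) \<mu>"
        unfolding almost_invariant_def by (meson order_trans)
      then show ?thesis by (simp add: T_def split_beta)
    qed
    then show "?M \<inter> \<Inter> \<F> \<noteq> {}" using \<mu>(1) J by auto
  qed
  then obtain \<mu> where \<mu>: "finitely_additive_prob (carrier G) \<mu>"
    and inv: "\<And>g \<epsilon>. g \<in> carrier G \<Longrightarrow> \<epsilon> > 0 \<Longrightarrow> almost_invariant G g \<epsilon> \<mu>"
    by (fastforce simp: T_def I_def)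
  have "\<mu> (g <#\<^bsub>G\<^esub> S) = \<mu> S" if "g \<in> carrier G" "S \<subseteq> carrier G" for g S
  proof -
    have "\<bar>\<mu> (g <#\<^bsub>G\<^esub> S) - \<mu> S\<bar> \<le> 0"
      by (rule field_le_epsilon) (use inv that in \<open>auto simp: almost_invariant_def\<close>)
    then show ?thesis by simp
  qed
  then have "left_invariant_mean G \<mu>"
    using \<mu> by (auto simp: left_invariant_mean_def finitely_additive_prob_def)
  then show ?thesis
    using \<open>group G\<close> by (auto simp: amenable_group_def)
qed

section \<open>Words\<close>

definition words :: "'j set \<Rightarrow> nat \<Rightarrow> 'j list set"
  where "words J n = {w. set w \<subseteq> J \<and> length w = n}"

lemma finite_words: "finite J \<Longrightarrow> finite (words J n)"
  by (simp add: words_def finite_lists_length_eq)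

lemma card_words: "finite J \<Longrightarrow> card (words J n) = card J ^ n"
  by (simp add: words_def card_lists_length_eq)

lemma words_0: "words J 0 = {[]}"
  by (auto simp: words_def)

text \<open>
  The first letter of a word is the one that acts last, so this is the recursion for one step of a
  random walk, with numbers of words in the place of probabilities.
\<close>

lemma card_words_Suc:
  assumes "finite J"
  shows "card {w \<in> words J (Suc n). P w} = (\<Sum>j\<in>J. card {w \<in> words J n. P (j # w)})"
proof -
  have "{w \<in> words J (Suc n). P w} = (\<Union>j\<in>J. (#) j ` {w \<in> words J n. P (j # w)})"
    by (auto simp: words_def length_Suc_conv image_iff)
  also have "card \<dots> = (\<Sum>j\<in>J. card ((#) j ` {w \<in> words J n. P (j # w)}))"
    using assms finite_words[OF assms] by (intro card_UN_disjoint) auto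
  also have "\<dots> = (\<Sum>j\<in>J. card {w \<in> words J n. P (j # w)})"
    by (intro sum.cong refl card_image) simp
  finally show ?thesis .
qed

section \<open>Slow decay of the square norms of a random walk\<close>

lemma (in group) sum_left_translate:
  fixes q :: "'a \<Rightarrow> real"
  assumes "s \<in> carrier G" "finite F" "F \<subseteq> carrier G" "F0 \<subseteq> carrier G"
    and "\<And>h. h \<in> carrier G \<Longrightarrow> h \<notin> F0 \<Longrightarrow> q h = 0"
    and "\<And>h. h \<in> F0 \<Longrightarrow> s \<otimes> h \<in> F"
  shows "(\<Sum>g\<in>F. q (inv s \<otimes> g)) = (\<Sum>h\<in>F0. q h)"
proof -
  have inv: "inv s \<otimes> (s \<otimes> h) = h" if "h \<in> carrier G" for h
    using that assms(1) by (simp flip: m_assoc)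
  have inj: "inj_on (\<lambda>h. s \<otimes> h) F0"
    using inv assms(4) by (intro inj_on_inverseI[where g = "\<lambda>g. inv s \<otimes> g"]) auto
  have "(\<Sum>g\<in>F. q (inv s \<otimes> g)) = (\<Sum>g\<in>(\<lambda>h. s \<otimes> h) ` F0. q (inv s \<otimes> g))"
  proof (rule sum.mono_neutral_right)
    show "\<forall>g\<in>F - (\<lambda>h. s \<otimes> h) ` F0. q (inv s \<otimes> g) = 0"
    proof
      fix g assume g: "g \<in> F - (\<lambda>h. s \<otimes> h) ` F0"
      then have gc: "g \<in> carrier G" using assms(3) by blast
      then have "g = s \<otimes> (inv s \<otimes> g)" using assms(1) by (simp flip: m_assoc)
      then have "inv s \<otimes> g \<notin> F0" using g by blast
      then show "q (inv s \<otimes> g) = 0" using assms(1,5) gc by simp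
    qed
  qed (use assms in auto)
  also have "\<dots> = (\<Sum>h\<in>F0. q h)"
    using inv assms(4) by (subst sum.reindex[OF inj]) (auto intro!: sum.cong)
  finally show ?thesis .
qed

lemma sum_pairwise_differences_squared:
  fixes a :: "'j \<Rightarrow> real"
  shows "(\<Sum>i\<in>J. \<Sum>j\<in>J. (a i - a j)\<^sup>2) = 2 * real (card J) * (\<Sum>j\<in>J. (a j)\<^sup>2) - 2 * (\<Sum>j\<in>J. a j)\<^sup>2"
proof -
  have "(\<Sum>i\<in>J. \<Sum>j\<in>J. (a i - a j)\<^sup>2)
      = (\<Sum>i\<in>J. \<Sum>j\<in>J. (a i)\<^sup>2) + (\<Sum>i\<in>J. \<Sum>j\<in>J. (a j)\<^sup>2) - 2 * (\<Sum>i\<in>J. \<Sum>j\<in>J. a i * a j)"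
    by (simp add: power2_diff sum.distrib sum_subtractf sum_distrib_left mult.assoc)
  also have "(\<Sum>i\<in>J. \<Sum>j\<in>J. a i * a j) = (\<Sum>j\<in>J. a j)\<^sup>2"
    by (simp add: power2_eq_square sum_product)
  finally show ?thesis
    by (simp add: sum_distrib_left mult.assoc)
qed

lemma square_sum_le: "(x + y)\<^sup>2 \<le> 2 * x\<^sup>2 + 2 * (y::real)\<^sup>2"
proof -
  have "0 \<le> (x - y)\<^sup>2" by simp
  then show ?thesis unfolding power2_diff power2_sum by linarith
qed

text \<open>
  Strict convexity of the Hilbert norm: if the sum of the \<open>card J\<close> translates of \<open>f\<close> is almost as
  long as \<open>card J\<close> times \<open>f\<close>, then the translates are close to each other. One of them is \<open>f\<close> itself,
  so \<open>f\<close> is almost invariant in square norm. By Cauchy--Schwarz the density \<open>f\<^sup>2\<close> is then almost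
  invariant in total mass.
\<close>

lemma (in group) almost_invariant_if_convolution_keeps_norm:
  fixes f :: "'a \<Rightarrow> real" and s :: "'j \<Rightarrow> 'a"
  assumes J: "finite J" "\<And>j. j \<in> J \<Longrightarrow> s j \<in> carrier G" and e: "e \<in> J" "s e = \<one>"
    and F0: "finite F0" "F0 \<subseteq> carrier G" and supp: "\<And>h. h \<in> carrier G \<Longrightarrow> h \<notin> F0 \<Longrightarrow> f h = 0"
    and F: "finite F" "F \<subseteq> carrier G" "\<And>j h. j \<in> J \<Longrightarrow> h \<in> F0 \<Longrightarrow> s j \<otimes> h \<in> F"
    and N: "N = (\<Sum>h\<in>F0. (f h)\<^sup>2)" "N > 0"
    and keep: "(1 - \<delta>) * (real (card J))\<^sup>2 * N \<le> (\<Sum>g\<in>F. (\<Sum>j\<in>J. f (inv (s j) \<otimes> g))\<^sup>2)"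
  shows "\<exists>\<mu>. finitely_additive_prob (carrier G) \<mu> \<and>
    (\<forall>j\<in>J. almost_invariant G (s j) (real (card J) * sqrt (8 * \<delta>)) \<mu>)"
proof -
  \<comment> \<open>The translates of \<open>f\<close>, and the probability measure with density proportional to \<open>f\<^sup>2\<close>.\<close>
  define a where "a j g = f (inv (s j) \<otimes> g)" for j g
  define \<mu> where "\<mu> S = (\<Sum>h\<in>F0 \<inter> S. (f h)\<^sup>2) / N" for S
  have norm_a: "(\<Sum>g\<in>F. (a j g)\<^sup>2) = N" if "j \<in> J" for j
    unfolding a_def N using that J F F0 supp
    by (intro sum_left_translate[of "s j" F F0 "\<lambda>h. (f h)\<^sup>2"]) auto
  have a_e: "a e g = f g" if "g \<in> F" for g
    using that e F by (auto simp: a_def)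
  have close: "(\<Sum>g\<in>F. (a j g - f g)\<^sup>2) \<le> 2 * \<delta> * (real (card J))\<^sup>2 * N" if j: "j \<in> J" for j
  proof -
    have "(\<Sum>g\<in>F. (a j g - f g)\<^sup>2) = (\<Sum>g\<in>F. (a j g - a e g)\<^sup>2)"
      using a_e by simp
    also have "\<dots> \<le> (\<Sum>j'\<in>J. \<Sum>g\<in>F. (a j g - a j' g)\<^sup>2)"
      using e J by (intro member_le_sum[where f = "\<lambda>j'. \<Sum>g\<in>F. (a j g - a j' g)\<^sup>2"]) (auto intro!: sum_nonneg)
    also have "\<dots> \<le> (\<Sum>i\<in>J. \<Sum>j'\<in>J. \<Sum>g\<in>F. (a i g - a j' g)\<^sup>2)"
      using j J by (intro member_le_sum[where f = "\<lambda>i. \<Sum>j'\<in>J. \<Sum>g\<in>F. (a i g - a j' g)\<^sup>2"])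
        (auto intro!: sum_nonneg)
    also have "\<dots> = (\<Sum>i\<in>J. \<Sum>g\<in>F. \<Sum>j'\<in>J. (a i g - a j' g)\<^sup>2)"
      by (intro sum.cong refl sum.swap)
    also have "\<dots> = (\<Sum>g\<in>F. \<Sum>i\<in>J. \<Sum>j'\<in>J. (a i g - a j' g)\<^sup>2)"
      by (rule sum.swap)
    also have "\<dots> = 2 * real (card J) * (\<Sum>g\<in>F. \<Sum>j\<in>J. (a j g)\<^sup>2) - 2 * (\<Sum>g\<in>F. (\<Sum>j\<in>J. a j g)\<^sup>2)"
      by (simp add: sum_pairwise_differences_squared sum_subtractf sum_distrib_left)
    also have "(\<Sum>g\<in>F. \<Sum>j\<in>J. (a j g)\<^sup>2) = real (card J) * N"
      by (subst sum.swap) (simp add: norm_a)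
    finally show ?thesis
      using keep by (simp add: a_def power2_eq_square algebra_simps)
  qed
  have add_prob: "finitely_additive_prob (carrier G) \<mu>"
    unfolding finitely_additive_prob_def
  proof (intro conjI allI impI)
    fix S T :: "'a set" assume "S \<inter> T = {}"
    then show "\<mu> (S \<union> T) = \<mu> S + \<mu> T"
      unfolding \<mu>_def Int_Un_distrib using F0
      by (subst sum.union_disjoint) (auto simp: add_divide_distrib)
  next
    show "\<mu> (carrier G) = 1"
      using N F0 by (simp add: \<mu>_def Int_absorb2)
    fix S
    show "0 \<le> \<mu> S" using N by (simp add: \<mu>_def sum_nonneg)
    have "(\<Sum>h\<in>F0 \<inter> S. (f h)\<^sup>2) \<le> N"
      unfolding N using F0 by (intro sum_mono2) auto
    then show "\<mu> S \<le> 1" using N by (simp add: \<mu>_def)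
  qed
  have "almost_invariant G (s j) (real (card J) * sqrt (8 * \<delta>)) \<mu>" if j: "j \<in> J" for j
    unfolding almost_invariant_def
  proof (intro allI impI)
    fix S assume S: "S \<subseteq> carrier G"
    let ?sS = "s j <# S"
    have mem: "g \<in> ?sS \<longleftrightarrow> inv (s j) \<otimes> g \<in> S" if "g \<in> carrier G" for g
    proof
      assume "g \<in> ?sS"
      then obtain h where "h \<in> S" "g = s j \<otimes> h" by (auto simp: l_coset_def)
      then show "inv (s j) \<otimes> g \<in> S"
        using S J(2)[OF j] by (auto simp flip: m_assoc)
    next
      assume "inv (s j) \<otimes> g \<in> S"
      moreover have "g = s j \<otimes> (inv (s j) \<otimes> g)"
        using that J(2)[OF j] by (simp flip: m_assoc)
      ultimately show "g \<in> ?sS" unfolding l_coset_def by blast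
    qed
    have supp': "h \<in> F0" if "h \<in> F" "f h \<noteq> 0" for h
      using that F supp by blast
    have "F0 \<subseteq> F" using F(3)[OF e(1)] e(2) F0 by (metis l_one subsetD subsetI)
    have nonneg: "0 \<le> 2 * \<delta> * (real (card J))\<^sup>2 * N"
      by (rule order_trans[OF sum_nonneg close[OF e(1)]]) simp
    have "N * \<mu> ?sS = (\<Sum>g\<in>F0 \<inter> ?sS. (f g)\<^sup>2)"
      using N by (simp add: \<mu>_def)
    also have "\<dots> = (\<Sum>g\<in>F \<inter> ?sS. (f g)\<^sup>2)"
      using \<open>F0 \<subseteq> F\<close> F supp' by (intro sum.mono_neutral_left) auto
    finally have 1: "N * \<mu> ?sS = (\<Sum>g\<in>F \<inter> ?sS. (f g)\<^sup>2)" .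
    have "N * \<mu> S = (\<Sum>h\<in>F0. if h \<in> S then (f h)\<^sup>2 else 0)"
      using N F0 by (simp add: \<mu>_def sum.inter_restrict)
    also have "\<dots> = (\<Sum>g\<in>F. if inv (s j) \<otimes> g \<in> S then (a j g)\<^sup>2 else 0)"
      unfolding a_def using j J F F0 supp
      by (intro sum_left_translate[of "s j" F F0 "\<lambda>h. if h \<in> S then (f h)\<^sup>2 else 0", symmetric]) auto
    also have "\<dots> = (\<Sum>g\<in>F. if g \<in> ?sS then (a j g)\<^sup>2 else 0)"
      using F mem by (intro sum.cong) auto
    also have "\<dots> = (\<Sum>g\<in>F \<inter> ?sS. (a j g)\<^sup>2)"
      using F by (simp add: sum.inter_restrict)
    finally have 2: "N * \<mu> S = (\<Sum>g\<in>F \<inter> ?sS. (a j g)\<^sup>2)" .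
    have "N * \<bar>\<mu> ?sS - \<mu> S\<bar> = \<bar>N * \<mu> ?sS - N * \<mu> S\<bar>"
      using N(2) by (simp add: abs_mult flip: right_diff_distrib)
    also have "\<dots> = \<bar>\<Sum>g\<in>F \<inter> ?sS. (f g)\<^sup>2 - (a j g)\<^sup>2\<bar>"
      unfolding 1 2 by (simp add: sum_subtractf)
    also have "\<dots> \<le> (\<Sum>g\<in>F \<inter> ?sS. \<bar>(f g)\<^sup>2 - (a j g)\<^sup>2\<bar>)"
      by (rule sum_abs)
    also have "\<dots> \<le> (\<Sum>g\<in>F. \<bar>(f g)\<^sup>2 - (a j g)\<^sup>2\<bar>)"
      using F by (intro sum_mono2) auto
    also have "\<dots> = (\<Sum>g\<in>F. \<bar>a j g - f g\<bar> * \<bar>a j g + f g\<bar>)"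
      by (intro sum.cong refl) (simp add: power2_eq_square algebra_simps flip: abs_mult)
    also have "\<dots> \<le> L2_set (\<lambda>g. a j g - f g) F * L2_set (\<lambda>g. a j g + f g) F"
      by (rule L2_set_mult_ineq)
    also have "\<dots> \<le> sqrt (2 * \<delta> * (real (card J))\<^sup>2 * N) * sqrt (4 * N)"
      unfolding L2_set_def
    proof (intro mult_mono real_sqrt_le_mono close j)
      have "(\<Sum>g\<in>F. (a j g + f g)\<^sup>2) \<le> (\<Sum>g\<in>F. 2 * (a j g)\<^sup>2 + 2 * (a e g)\<^sup>2)"
        using a_e by (intro sum_mono) (simp add: square_sum_le)
      also have "\<dots> = 4 * N"
        using norm_a j e by (simp add: sum.distrib flip: sum_distrib_left)
      finally show "(\<Sum>g\<in>F. (a j g + f g)\<^sup>2) \<le> 4 * N" .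
    qed (use nonneg in \<open>auto intro!: sum_nonneg\<close>)
    also have "\<dots> = sqrt ((real (card J))\<^sup>2 * N\<^sup>2 * (8 * \<delta>))"
      by (simp add: power2_eq_square algebra_simps flip: real_sqrt_mult)
    also have "\<dots> = N * (real (card J) * sqrt (8 * \<delta>))"
      using N(2) by (simp add: real_sqrt_mult)
    finally show "\<bar>\<mu> ?sS - \<mu> S\<bar> \<le> real (card J) * sqrt (8 * \<delta>)"
      using N(2) by simp
  qed
  then show ?thesis using add_prob by blast
qed


definition (in group) word_prod :: "('j \<Rightarrow> 'a) \<Rightarrow> 'j list \<Rightarrow> 'a"
  where "word_prod s w = foldr (\<lambda>j g. s j \<otimes> g) w \<one>"

lemma (in group) word_prod_closed:
  "set w \<subseteq> J \<Longrightarrow> (\<And>j. j \<in> J \<Longrightarrow> s j \<in> carrier G) \<Longrightarrow> word_prod s w \<in> carrier G"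
  by (induction w) (auto simp: word_prod_def)

text \<open>
  The half of Kesten's criterion that produces almost invariant vectors. Let \<open>N n\<close> be the squared
  norm of the distribution after \<open>n\<close> steps. By Cauchy--Schwarz a distribution that puts half of its
  mass on few elements has a large norm, so the hypothesis says that \<open>N n\<close>, normalised by
  \<open>card J ^ (2 * n)\<close>, does not decay exponentially. Hence some single step loses almost no norm, and
  the preceding lemma applies to the distribution before that step.
\<close>

lemma (in group) almost_invariant_if_word_products_concentrate:
  fixes s :: "'j \<Rightarrow> 'a"
  assumes J: "finite J" "\<And>j. j \<in> J \<Longrightarrow> s j \<in> carrier G" and e: "e \<in> J" "s e = \<one>"
    and small: "\<And>c::real. c > 0 \<Longrightarrow> \<exists>n W. W \<subseteq> words J n \<and> card J ^ n \<le> 2 * card W \<and>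
      4 * real (card (word_prod s ` W)) < exp (c * real n)"
    and "\<epsilon> > 0"
  shows "\<exists>\<mu>. finitely_additive_prob (carrier G) \<mu> \<and> (\<forall>j\<in>J. almost_invariant G (s j) \<epsilon> \<mu>)"
proof -
  define d where "d = real (card J)"
  have d: "d \<ge> 1" using J e by (auto simp: d_def Suc_le_eq card_gt_0_iff)
  define f where "f n g = real (card {w \<in> words J n. word_prod s w = g})" for n g
  define E where "E n = word_prod s ` words J n" for n
  define N where "N n = (\<Sum>g\<in>E n. (f n g)\<^sup>2)" for n
  have fin: "finite (E n)" for n by (simp add: E_def finite_words J)
  have words_closed: "word_prod s w \<in> carrier G" if "w \<in> words J n" for w n
    using that word_prod_closed[of w J s] J(2) by (auto simp: words_def)
  have E_carrier: "E n \<subseteq> carrier G" for n using words_closed by (auto simp: E_def)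
  have supp: "f n g = 0" if "g \<notin> E n" for n g
    using that by (auto simp: f_def E_def card_eq_0_iff)
  have E_step: "s j \<otimes> h \<in> E (Suc n)" if "j \<in> J" "h \<in> E n" for j h n
  proof -
    obtain w where "w \<in> words J n" "h = word_prod s w" using \<open>h \<in> E n\<close> by (auto simp: E_def)
    then have "s j \<otimes> h = word_prod s (j # w)" "j # w \<in> words J (Suc n)"
      using \<open>j \<in> J\<close> by (auto simp: word_prod_def words_def)
    then show ?thesis unfolding E_def by blast
  qed
  have f_step: "f (Suc n) g = (\<Sum>j\<in>J. f n (inv (s j) \<otimes> g))" if "g \<in> carrier G" for n g
  proof -
    have "(word_prod s (j # w) = g) = (word_prod s w = inv (s j) \<otimes> g)"
      if "j \<in> J" "w \<in> words J n" for j w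
      using J(2)[OF \<open>j \<in> J\<close>] words_closed[OF \<open>w \<in> words J n\<close>] \<open>g \<in> carrier G\<close>
      by (auto simp: word_prod_def simp flip: m_assoc)
    then have "{w \<in> words J n. word_prod s (j # w) = g} = {w \<in> words J n. word_prod s w = inv (s j) \<otimes> g}"
      if "j \<in> J" for j using that by auto
    then show ?thesis
      by (simp add: f_def card_words_Suc[OF J(1)] cong: sum.cong)
  qed
  have N_0: "N 0 = 1"
  proof -
    have "{w \<in> words J 0. word_prod s w = \<one>} = {[]}"
      by (auto simp: words_0 word_prod_def)
    then show ?thesis by (simp add: N_def E_def f_def words_0 word_prod_def)
  qed
  have N_pos: "N n > 0" for n
  proof -
    have "replicate n e \<in> words J n" using e by (auto simp: words_def)
    moreover have "f n (word_prod s w) \<noteq> 0" if "w \<in> words J n" for w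
      using that finite_words[OF J(1), of n] by (auto simp: f_def card_eq_0_iff)
    ultimately show ?thesis
      unfolding N_def using fin by (intro sum_pos) (auto simp: E_def)
  qed
  have N_large: "(real (card W))\<^sup>2 \<le> real (card (word_prod s ` W)) * N n" if W: "W \<subseteq> words J n" for W n
  proof -
    have finW: "finite W" using W finite_words[OF J(1)] finite_subset by blast
    have "real (card W) = (\<Sum>g\<in>word_prod s ` W. real (card {w \<in> W. word_prod s w = g}))"
      using sum.group[of W "word_prod s ` W" "word_prod s" "\<lambda>_. 1::real"] finW by simp
    also have "\<dots> \<le> (\<Sum>g\<in>word_prod s ` W. f n g)"
      unfolding f_def using W finite_words[OF J(1), of n]
      by (intro sum_mono of_nat_mono card_mono) auto
    finally have "(real (card W))\<^sup>2 \<le> (\<Sum>g\<in>word_prod s ` W. 1 * f n g)\<^sup>2"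
      by (simp add: power_mono)
    also have "\<dots> \<le> (\<Sum>g\<in>word_prod s ` W. 1\<^sup>2) * (\<Sum>g\<in>word_prod s ` W. (f n g)\<^sup>2)"
      by (rule Cauchy_Schwarz_ineq_sum)
    also have "\<dots> \<le> real (card (word_prod s ` W)) * N n"
      unfolding N_def using fin W
      by (auto simp: E_def intro!: mult_left_mono sum_mono2)
    finally show ?thesis .
  qed
  \<comment> \<open>With this \<open>\<delta>\<close> the tolerance \<open>card J * sqrt (8 * \<delta>)\<close> of the convexity lemma is at most \<open>\<epsilon>\<close>.\<close>
  define \<delta> where "\<delta> = min (1 / 2) (\<epsilon>\<^sup>2 / (8 * d\<^sup>2))"
  have \<delta>: "\<delta> > 0" "\<delta> < 1" using \<open>\<epsilon> > 0\<close> d by (auto simp: \<delta>_def)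
  have "\<exists>n. (1 - \<delta>) * d\<^sup>2 * N n \<le> N (Suc n)"
  proof (rule ccontr)
    assume "\<not> ?thesis"
    then have dec: "N (Suc n) \<le> (1 - \<delta>) * d\<^sup>2 * N n" for n by (simp add: not_le less_imp_le)
    have decay: "N n \<le> ((1 - \<delta>) * d\<^sup>2) ^ n" for n
    proof (induction n)
      case (Suc n)
      have "N (Suc n) \<le> (1 - \<delta>) * d\<^sup>2 * ((1 - \<delta>) * d\<^sup>2) ^ n"
        using dec[of n] Suc \<delta> d by (meson mult_left_mono order_trans mult_nonneg_nonneg
            less_imp_le diff_ge_0_iff_ge zero_le_power2)
      then show ?case by simp
    qed (simp add: N_0)
    obtain n W where W: "W \<subseteq> words J n" "card J ^ n \<le> 2 * card W"
      "4 * real (card (word_prod s ` W)) < exp (- ln (1 - \<delta>) * real n)"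
      using small[of "- ln (1 - \<delta>)"] \<delta> by auto
    let ?m = "real (card (word_prod s ` W))"
    have "exp (- ln (1 - \<delta>) * real n) * (1 - \<delta>) ^ n = 1"
      using \<delta> by (simp add: exp_minus exp_of_nat_mult mult.commute[of "ln (1 - \<delta>)"])
    then have m: "4 * ?m * (1 - \<delta>) ^ n < 1"
      using W(3) \<delta> by (metis mult_strict_right_mono zero_less_power diff_gt_0_iff_gt)
    have "d ^ n \<le> 2 * real (card W)"
      using W(2) by (simp add: d_def flip: of_nat_power of_nat_mult)
    then have "(d ^ n)\<^sup>2 \<le> (2 * real (card W))\<^sup>2"
      using d by (intro power_mono) auto
    also have "\<dots> = 4 * (real (card W))\<^sup>2" by simp
    also have "\<dots> \<le> 4 * (?m * N n)" using N_large[OF W(1)] by simp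
    also have "\<dots> \<le> 4 * (?m * ((1 - \<delta>) * d\<^sup>2) ^ n)"
      using decay by (intro mult_left_mono) auto
    also have "\<dots> = (4 * ?m * (1 - \<delta>) ^ n) * (d ^ n)\<^sup>2"
      by (simp add: power_mult_distrib power_mult[symmetric] mult.commute)
    also have "\<dots> < 1 * (d ^ n)\<^sup>2"
      using m d by (intro mult_strict_right_mono) auto
    finally show False by simp
  qed
  then obtain n where n: "(1 - \<delta>) * d\<^sup>2 * N n \<le> N (Suc n)" ..
  have "N (Suc n) = (\<Sum>g\<in>E (Suc n). (\<Sum>j\<in>J. f n (inv (s j) \<otimes> g))\<^sup>2)"
    unfolding N_def using f_step E_carrier by (intro sum.cong refl) (auto simp: subset_iff)
  then have keep: "(1 - \<delta>) * (real (card J))\<^sup>2 * N n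
      \<le> (\<Sum>g\<in>E (Suc n). (\<Sum>j\<in>J. f n (inv (s j) \<otimes> g))\<^sup>2)"
    using n by (simp add: d_def)
  have "\<exists>\<mu>. finitely_additive_prob (carrier G) \<mu> \<and>
      (\<forall>j\<in>J. almost_invariant G (s j) (real (card J) * sqrt (8 * \<delta>)) \<mu>)"
    by (rule almost_invariant_if_convolution_keeps_norm[where s = s and f = "f n" and e = e])
      (use J e fin E_carrier supp E_step keep N_pos in \<open>auto simp: N_def\<close>)
  then obtain \<mu> where \<mu>: "finitely_additive_prob (carrier G) \<mu>"
      "\<And>j. j \<in> J \<Longrightarrow> almost_invariant G (s j) (d * sqrt (8 * \<delta>)) \<mu>"
    by (auto simp: d_def)
  have "d * sqrt (8 * \<delta>) \<le> d * sqrt (8 * (\<epsilon>\<^sup>2 / (8 * d\<^sup>2)))"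
    using d by (intro mult_left_mono real_sqrt_le_mono) (auto simp: \<delta>_def)
  also have "\<dots> = \<epsilon>" using d \<open>\<epsilon> > 0\<close> by (simp add: real_sqrt_divide)
  finally have "almost_invariant G (s j) \<epsilon> \<mu>" if "j \<in> J" for j
    using \<mu>(2)[OF that] unfolding almost_invariant_def by (meson order_trans)
  then show ?thesis using \<mu>(1) by blast
qed

section \<open>Gaussian tails for lazy walks on the integers\<close>

lemma lazy_step_expansion_bound:
  fixes a b h :: real
  shows "(a + b + h)\<^sup>2 \<le> 2 * a\<^sup>2 + 2 * b\<^sup>2 + 2 * h\<^sup>2 + 4 * (a * h)"
proof -
  have "0 \<le> (b - a - h)\<^sup>2" by simp
  then show ?thesis by (simp add: power2_eq_square algebra_simps)
qed

text \<open>
  One step of a lazy symmetric walk, conjugated by an exponential weight. With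
  \<open>\<theta> k x = \<beta> * (x - \<pi> k x)\<close> and \<open>F = exp (\<beta> * x) * u\<close>, the sum on the left is the weighted norm
  of the distribution after the step. An operator norm of \<open>cosh c\<close>, without a term linear in \<open>c\<close>, is
  what makes the tails Gaussian, and laziness is what gives it: split \<open>exp \<theta>\<close> into the
  symmetric part \<open>G\<close> (with \<open>cosh \<theta>\<close>) and the antisymmetric part \<open>H\<close> (with \<open>sinh \<theta>\<close>). The only
  term of first order that is not absorbed by squares is the pairing of \<open>F\<close> with \<open>H\<close>, and it vanishes
  by antisymmetry. What remains is at most
  \<open>2 * n\<^sup>2 * (1 + cosh (2 * c)) = (2 * n * cosh c)\<^sup>2\<close> times the square norm of \<open>F\<close>.
\<close>

lemma weighted_lazy_step_norm:
  fixes \<pi> :: "'k \<Rightarrow> 'x \<Rightarrow> 'x" and \<theta> :: "'k \<Rightarrow> 'x \<Rightarrow> real" and F :: "'x \<Rightarrow> real"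
  assumes K: "finite K" "\<And>k. k \<in> K \<Longrightarrow> \<iota> k \<in> K" "\<And>k. k \<in> K \<Longrightarrow> \<iota> (\<iota> k) = k"
    and \<pi>: "\<And>k x. k \<in> K \<Longrightarrow> \<pi> (\<iota> k) (\<pi> k x) = x"
    and \<theta>: "\<And>k x. k \<in> K \<Longrightarrow> \<theta> (\<iota> k) (\<pi> k x) = - \<theta> k x" "\<And>k x. k \<in> K \<Longrightarrow> \<bar>\<theta> k x\<bar> \<le> c"
    and A: "finite A" and S: "finite S" "\<And>x. x \<notin> S \<Longrightarrow> F x = 0"
  shows "(\<Sum>x\<in>A. (real (card K) * F x + (\<Sum>k\<in>K. exp (\<theta> k x) * F (\<pi> k x)))\<^sup>2)
    \<le> (2 * real (card K) * cosh c)\<^sup>2 * (\<Sum>x\<in>S. (F x)\<^sup>2)"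
proof -
  define n where "n = real (card K)"
  define N where "N = (\<Sum>x\<in>S. (F x)\<^sup>2)"
  define B where "B = A \<union> S"
  define G where "G x = (\<Sum>k\<in>K. cosh (\<theta> k x) * F (\<pi> k x))" for x
  define H where "H x = (\<Sum>k\<in>K. sinh (\<theta> k x) * F (\<pi> k x))" for x
  have B: "finite B" using A S by (simp add: B_def)
  have F_supp: "x \<in> S" if "F x \<noteq> 0" for x using S(2) that by blast
  have split: "(\<Sum>k\<in>K. exp (\<theta> k x) * F (\<pi> k x)) = G x + H x" for x
    by (simp add: G_def H_def ring_distribs flip: sum.distrib cosh_plus_sinh)
  have inj: "inj_on (\<pi> k) B" if "k \<in> K" for k
    using \<pi>[OF that] by (intro inj_on_inverseI[where g = "\<pi> (\<iota> k)"])
  have translate: "(\<Sum>x\<in>B. (F (\<pi> k x))\<^sup>2) \<le> N" if k: "k \<in> K" for k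
  proof -
    have "(\<Sum>x\<in>B. (F (\<pi> k x))\<^sup>2) = (\<Sum>y\<in>\<pi> k ` B. (F y)\<^sup>2)"
      by (simp add: sum.reindex[OF inj[OF k]])
    also have "\<dots> = (\<Sum>y\<in>\<pi> k ` B \<inter> S. (F y)\<^sup>2)"
      using B S by (intro sum.mono_neutral_right) auto
    also have "\<dots> \<le> N"
      unfolding N_def using S by (intro sum_mono2) auto
    finally show ?thesis .
  qed
  have antisymmetric: "(\<Sum>x\<in>B. F x * H x) = 0"
  proof -
    define t where "t = (\<lambda>(k, x). F x * (sinh (\<theta> k x) * F (\<pi> k x)))"
    define P where "P = {(k, x). k \<in> K \<and> x \<in> S \<and> \<pi> k x \<in> S}"
    have "finite P"
      using K S by (intro finite_subset[of P "K \<times> S"]) (auto simp: P_def)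
    have "(\<Sum>x\<in>B. F x * H x) = (\<Sum>k\<in>K. \<Sum>x\<in>B. t (k, x))"
      by (simp add: H_def t_def sum_distrib_left) (rule sum.swap)
    also have "\<dots> = (\<Sum>p\<in>K \<times> B. t p)"
      by (simp add: sum.cartesian_product)
    also have "\<dots> = (\<Sum>p\<in>P. t p)"
      using K(1) B F_supp by (intro sum.mono_neutral_right) (auto simp: P_def t_def B_def)
    finally have "(\<Sum>x\<in>B. F x * H x) = (\<Sum>p\<in>P. t p)" .
    moreover have "(\<Sum>p\<in>P. t p) = (\<Sum>p\<in>P. - t p)"
      \<comment> \<open>Reversing an edge is an involution of \<open>P\<close> that changes the sign of the summand.\<close>
    proof (rule sum.reindex_bij_witness[where i = "\<lambda>(k, x). (\<iota> k, \<pi> k x)" and j = "\<lambda>(k, x). (\<iota> k, \<pi> k x)"])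
      fix p assume "p \<in> P"
      then obtain k x where p: "p = (k, x)" "k \<in> K" "x \<in> S" "\<pi> k x \<in> S" by (auto simp: P_def)
      let ?r = "\<lambda>(k, x). (\<iota> k, \<pi> k x)"
      show "?r (?r p) = p" "?r (?r p) = p"
        by (simp_all add: p(1) K(3)[OF p(2)] \<pi>[OF p(2)])
      show "?r p \<in> P" "?r p \<in> P"
        using p K(2)[OF p(2)] by (simp_all add: P_def \<pi>[OF p(2)])
      show "- t (?r p) = t p"
        by (simp add: t_def p(1) \<pi>[OF p(2)] \<theta>(1)[OF p(2)])
    qed
    ultimately show ?thesis unfolding sum_negf by linarith
  qed
  have GH: "(G x)\<^sup>2 + (H x)\<^sup>2 \<le> n * cosh (2 * c) * (\<Sum>k\<in>K. (F (\<pi> k x))\<^sup>2)" for x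
  proof -
    have "(G x)\<^sup>2 = (\<Sum>k\<in>K. 1 * (cosh (\<theta> k x) * F (\<pi> k x)))\<^sup>2" by (simp add: G_def)
    also have "\<dots> \<le> (\<Sum>k\<in>K. 1\<^sup>2) * (\<Sum>k\<in>K. (cosh (\<theta> k x) * F (\<pi> k x))\<^sup>2)"
      by (rule Cauchy_Schwarz_ineq_sum)
    finally have 1: "(G x)\<^sup>2 \<le> n * (\<Sum>k\<in>K. (cosh (\<theta> k x) * F (\<pi> k x))\<^sup>2)"
      by (simp add: n_def)
    have "(H x)\<^sup>2 = (\<Sum>k\<in>K. 1 * (sinh (\<theta> k x) * F (\<pi> k x)))\<^sup>2" by (simp add: H_def)
    also have "\<dots> \<le> (\<Sum>k\<in>K. 1\<^sup>2) * (\<Sum>k\<in>K. (sinh (\<theta> k x) * F (\<pi> k x))\<^sup>2)"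
      by (rule Cauchy_Schwarz_ineq_sum)
    finally have 2: "(H x)\<^sup>2 \<le> n * (\<Sum>k\<in>K. (sinh (\<theta> k x) * F (\<pi> k x))\<^sup>2)"
      by (simp add: n_def)
    have "(G x)\<^sup>2 + (H x)\<^sup>2 \<le> n * (\<Sum>k\<in>K. cosh (2 * \<theta> k x) * (F (\<pi> k x))\<^sup>2)"
      using 1 2 by (simp add: cosh_double power_mult_distrib ring_distribs sum.distrib)
    also have "\<dots> \<le> n * (\<Sum>k\<in>K. cosh (2 * c) * (F (\<pi> k x))\<^sup>2)"
    proof (intro mult_left_mono sum_mono mult_right_mono)
      fix k assume "k \<in> K"
      then have "\<bar>2 * \<theta> k x\<bar> \<le> 2 * c" using \<theta>(2)[of k x] by simp
      then have "cosh \<bar>2 * \<theta> k x\<bar> \<le> cosh (2 * c)"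
        by (subst cosh_real_nonneg_le_iff) auto
      then show "cosh (2 * \<theta> k x) \<le> cosh (2 * c)" by (simp only: cosh_real_abs)
    qed (auto simp: n_def)
    finally show ?thesis by (simp add: mult.assoc sum_distrib_left)
  qed
  have "(\<Sum>x\<in>A. (n * F x + (G x + H x))\<^sup>2) \<le> (\<Sum>x\<in>B. (n * F x + (G x + H x))\<^sup>2)"
    using B by (intro sum_mono2) (auto simp: B_def)
  also have "\<dots> \<le> (\<Sum>x\<in>B. 2 * (n * F x)\<^sup>2 + 2 * (n * cosh (2 * c) * (\<Sum>k\<in>K. (F (\<pi> k x))\<^sup>2)) + 4 * n * (F x * H x))"
  proof (rule sum_mono)
    fix x
    show "(n * F x + (G x + H x))\<^sup>2 \<le> 2 * (n * F x)\<^sup>2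
        + 2 * (n * cosh (2 * c) * (\<Sum>k\<in>K. (F (\<pi> k x))\<^sup>2)) + 4 * n * (F x * H x)"
      using lazy_step_expansion_bound[of "n * F x" "G x" "H x"] GH[of x]
      by (simp add: algebra_simps)
  qed
  also have "\<dots> = 2 * n\<^sup>2 * (\<Sum>x\<in>B. (F x)\<^sup>2) + 2 * n * cosh (2 * c) * (\<Sum>x\<in>B. \<Sum>k\<in>K. (F (\<pi> k x))\<^sup>2)
      + 4 * n * (\<Sum>x\<in>B. F x * H x)"
    by (simp only: sum.distrib sum_distrib_left power_mult_distrib mult.assoc)
  also have "(\<Sum>x\<in>B. F x * H x) = 0" by (rule antisymmetric)
  also have "(\<Sum>x\<in>B. (F x)\<^sup>2) = N"
    unfolding N_def using B S by (intro sum.mono_neutral_right) (auto simp: B_def)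
  also have "2 * n\<^sup>2 * N + 2 * n * cosh (2 * c) * (\<Sum>x\<in>B. \<Sum>k\<in>K. (F (\<pi> k x))\<^sup>2) + 4 * n * 0
      \<le> 2 * n\<^sup>2 * N + 2 * n * cosh (2 * c) * (n * N)"
  proof -
    have "(\<Sum>x\<in>B. \<Sum>k\<in>K. (F (\<pi> k x))\<^sup>2) = (\<Sum>k\<in>K. \<Sum>x\<in>B. (F (\<pi> k x))\<^sup>2)"
      by (rule sum.swap)
    also have "\<dots> \<le> (\<Sum>k\<in>K. N)" by (intro sum_mono translate)
    finally have "(\<Sum>x\<in>B. \<Sum>k\<in>K. (F (\<pi> k x))\<^sup>2) \<le> n * N" by (simp add: n_def)
    then have "2 * n * cosh (2 * c) * (\<Sum>x\<in>B. \<Sum>k\<in>K. (F (\<pi> k x))\<^sup>2) \<le> 2 * n * cosh (2 * c) * (n * N)"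
      by (intro mult_left_mono) (auto simp: n_def)
    then show ?thesis by simp
  qed
  also have "\<dots> = (2 * n * cosh c)\<^sup>2 * N"
    unfolding cosh_double_cosh by (simp add: power2_eq_square algebra_simps)
  finally show ?thesis by (simp add: n_def N_def split)
qed

lemma cosh_le_exp_square:
  fixes t :: real
  assumes "\<bar>t\<bar> \<le> 1"
  shows "cosh t \<le> exp (t\<^sup>2)"
proof -
  define u where "u = \<bar>t\<bar>"
  have u: "0 \<le> u" "u \<le> 1" "u\<^sup>2 = t\<^sup>2" using assms by (auto simp: u_def)
  have "exp (- u) \<le> 1 / (1 + u)"
    using exp_ge_add_one_self[of u] u by (simp add: exp_minus inverse_eq_divide frac_le)
  also have "\<dots> \<le> 1 - u + u\<^sup>2"
  proof -
    have "(1 - u + u\<^sup>2) * (1 + u) = 1 + u ^ 3"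
      by (simp add: power2_eq_square power3_eq_cube algebra_simps)
    then show ?thesis using u by (simp add: pos_divide_le_eq)
  qed
  finally have "exp (- u) \<le> 1 - u + u\<^sup>2" .
  moreover have "exp u \<le> 1 + u + u\<^sup>2" using u by (intro exp_bound) auto
  ultimately have "cosh u \<le> 1 + u\<^sup>2"
    by (simp add: cosh_field_def)
  also have "\<dots> \<le> exp (u\<^sup>2)" by (rule exp_ge_add_one_self)
  finally show ?thesis using u by (simp add: u_def)
qed

lemma sum_UNIV_bool: "(\<Sum>b\<in>UNIV. f b) = f False + (f True :: real)"
  by (simp add: UNIV_bool)

text \<open>
  A letter \<open>(b, k)\<close> moves by \<open>\<pi> k\<close> if \<open>b\<close> holds and rests otherwise; a uniformly random word over
  \<open>UNIV \<times> K\<close> is thus the lazy random walk, which rests with probability one half at each time. Words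
  are read from right to left.
\<close>

definition lazy_walk :: "('k \<Rightarrow> int \<Rightarrow> int) \<Rightarrow> (bool \<times> 'k) list \<Rightarrow> int"
  where "lazy_walk \<pi> w = foldr (\<lambda>(b, k) p. if b then \<pi> k p else p) w 0"

lemma lazy_walk_simps [simp]:
  "lazy_walk \<pi> [] = 0"
  "lazy_walk \<pi> ((b, k) # w) = (if b then \<pi> k (lazy_walk \<pi> w) else lazy_walk \<pi> w)"
  by (simp_all add: lazy_walk_def)

context
  fixes \<pi> :: "'k \<Rightarrow> int \<Rightarrow> int" and \<iota> :: "'k \<Rightarrow> 'k" and K :: "'k set" and D :: nat
  assumes K: "finite K" "\<And>k. k \<in> K \<Longrightarrow> \<iota> k \<in> K" "\<And>k. k \<in> K \<Longrightarrow> \<iota> (\<iota> k) = k"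
    and \<pi>: "\<And>k x. k \<in> K \<Longrightarrow> \<pi> (\<iota> k) (\<pi> k x) = x"
    and D: "\<And>k x. k \<in> K \<Longrightarrow> \<bar>\<pi> k x - x\<bar> \<le> int D"
begin

lemma lazy_walk_bound: "w \<in> words (UNIV \<times> K) n \<Longrightarrow> \<bar>lazy_walk \<pi> w\<bar> \<le> int (n * D)"
proof (induction n arbitrary: w)
  case (Suc n)
  then obtain b k v where w: "w = (b, k) # v" "k \<in> K" "v \<in> words (UNIV \<times> K) n"
    by (auto simp: words_def length_Suc_conv)
  show ?case
    using Suc.IH[OF w(3)] D[OF w(2), of "lazy_walk \<pi> v"] by (cases b; simp add: w(1) algebra_simps; linarith)
qed (simp add: words_0)

text \<open>
  The weighted norm of the distribution grows by a factor of at most \<open>2 * card K * cosh (\<beta> * D)\<close>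
  with each letter, and it bounds every single weighted value.
\<close>

lemma lazy_walk_exponential_bound:
  fixes \<beta> :: real and y :: int
  shows "real (card {w \<in> words (UNIV \<times> K) n. lazy_walk \<pi> w = y}) * exp (\<beta> * y)
    \<le> (2 * real (card K) * cosh (\<beta> * D)) ^ n"
proof -
  define J where "J = (UNIV :: bool set) \<times> K"
  define M where "M = 2 * real (card K) * cosh (\<beta> * D)"
  have J: "finite J" using K by (simp add: J_def)
  define u where "u n y = real (card {w \<in> words J n. lazy_walk \<pi> w = y})" for n and y :: int
  define S where "S n = lazy_walk \<pi> ` words J n" for n
  have S: "finite (S n)" for n by (simp add: S_def finite_words J)
  have supp: "u n y = 0" if "y \<notin> S n" for n y
    using that by (auto simp: u_def S_def card_eq_0_iff)
  have \<pi>_eq: "\<pi> k p = y \<longleftrightarrow> p = \<pi> (\<iota> k) y" if "k \<in> K" for k p y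
    using \<pi>[OF that, of p] \<pi>[OF K(2)[OF that], of y] K(3)[OF that] by auto
  have step: "u (Suc n) y = real (card K) * u n y + (\<Sum>k\<in>K. u n (\<pi> k y))" for n y
  proof -
    have "u (Suc n) y = (\<Sum>j\<in>J. real (card {w \<in> words J n. lazy_walk \<pi> (j # w) = y}))"
      by (simp add: u_def card_words_Suc[OF J])
    also have "\<dots> = (\<Sum>b\<in>UNIV. \<Sum>k\<in>K. real (card {w \<in> words J n. lazy_walk \<pi> ((b, k) # w) = y}))"
      unfolding J_def sum.cartesian_product by (intro sum.cong refl) (simp only: split_beta prod.collapse)
    also have "\<dots> = (\<Sum>k\<in>K. real (card {w \<in> words J n. lazy_walk \<pi> ((False, k) # w) = y}))
        + (\<Sum>k\<in>K. real (card {w \<in> words J n. lazy_walk \<pi> ((True, k) # w) = y}))"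
      by (rule sum_UNIV_bool)
    also have "\<dots> = (\<Sum>k\<in>K. u n y) + (\<Sum>k\<in>K. real (card {w \<in> words J n. \<pi> k (lazy_walk \<pi> w) = y}))"
      by (simp add: u_def)
    also have "(\<Sum>k\<in>K. real (card {w \<in> words J n. \<pi> k (lazy_walk \<pi> w) = y})) = (\<Sum>k\<in>K. u n (\<pi> (\<iota> k) y))"
      by (simp add: u_def \<pi>_eq cong: sum.cong)
    also have "\<dots> = (\<Sum>k\<in>K. u n (\<pi> k y))"
      by (rule sum.reindex_bij_witness[where i = \<iota> and j = \<iota>]) (use K in auto)
    finally show ?thesis by simp
  qed
  define F where "F n y = exp (\<beta> * y) * u n y" for n and y :: int
  have norm: "(\<Sum>y\<in>S n. (F n y)\<^sup>2) \<le> (M ^ n)\<^sup>2" for n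
  proof (induction n)
    case 0
    have "{w \<in> words J 0. lazy_walk \<pi> w = 0} = {[]}" by (auto simp: words_0)
    then show ?case by (simp add: S_def words_0 F_def u_def)
  next
    case (Suc n)
    define \<theta> where "\<theta> k y = \<beta> * real_of_int (y - \<pi> k y)" for k y
    have F_step: "F (Suc n) y = real (card K) * F n y + (\<Sum>k\<in>K. exp (\<theta> k y) * F n (\<pi> k y))" for y
    proof -
      have *: "exp (\<theta> k y) * F n (\<pi> k y) = exp (\<beta> * y) * u n (\<pi> k y)" for k
        by (simp add: F_def \<theta>_def algebra_simps flip: exp_add)
      have "F (Suc n) y = real (card K) * F n y + (\<Sum>k\<in>K. exp (\<beta> * y) * u n (\<pi> k y))"
        by (simp add: F_def step ring_distribs sum_distrib_left)
      then show ?thesis by (simp only: *)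
    qed
    have "(\<Sum>y\<in>S (Suc n). (F (Suc n) y)\<^sup>2)
        \<le> (2 * real (card K) * cosh \<bar>\<beta> * D\<bar>)\<^sup>2 * (\<Sum>y\<in>S n. (F n y)\<^sup>2)"
      unfolding F_step
    proof (rule weighted_lazy_step_norm[where \<iota> = \<iota>])
      fix k y assume k: "k \<in> K"
      show "\<theta> (\<iota> k) (\<pi> k y) = - \<theta> k y"
        using \<pi>[OF k] by (simp add: \<theta>_def algebra_simps)
      have "\<bar>real_of_int (y - \<pi> k y)\<bar> \<le> real D" using D[OF k, of y] by linarith
      then show "\<bar>\<theta> k y\<bar> \<le> \<bar>\<beta> * D\<bar>"
        by (simp add: \<theta>_def abs_mult mult_left_mono del: of_int_diff)
    qed (use K \<pi> S in \<open>auto simp: F_def supp\<close>)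
    also have "\<dots> = M\<^sup>2 * (\<Sum>y\<in>S n. (F n y)\<^sup>2)"
      by (simp only: M_def cosh_real_abs)
    also have "\<dots> \<le> M\<^sup>2 * (M ^ n)\<^sup>2" using Suc by (intro mult_left_mono) auto
    also have "\<dots> = (M ^ Suc n)\<^sup>2" by (simp add: power_mult_distrib)
    finally show ?case .
  qed
  have "F n y \<le> M ^ n"
  proof (cases "y \<in> S n")
    case True
    then have "(F n y)\<^sup>2 \<le> (\<Sum>y\<in>S n. (F n y)\<^sup>2)"
      using S by (intro member_le_sum) auto
    also note norm
    finally show ?thesis by (rule power2_le_imp_le) (simp add: M_def)
  qed (simp add: F_def supp M_def)
  then show ?thesis by (simp add: F_def u_def M_def J_def mult.commute)
qed

text \<open>
  Sum the exponential bounds with weights \<open>\<beta>\<close> and \<open>- \<beta>\<close> over the at most \<open>2 * n * D + 1\<close>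
  endpoints that the walk can reach.
\<close>

lemma lazy_walk_tail:
  fixes \<beta> :: real
  assumes "\<beta> \<ge> 0"
  shows "real (card {w \<in> words (UNIV \<times> K) n. \<bar>lazy_walk \<pi> w\<bar> > int R})
    \<le> real (2 * n * D + 1) * (exp (- \<beta> * R) * cosh (\<beta> * D) ^ n) * real (card (UNIV \<times> K :: (bool \<times> 'k) set)) ^ n"
proof -
  define J where "J = (UNIV :: bool set) \<times> K"
  define M where "M = 2 * real (card K) * cosh (\<beta> * D)"
  define Y where "Y = {- int (n * D)..int (n * D)} \<inter> {y. \<bar>y\<bar> > int R}"
  have finY: "finite Y" by (simp add: Y_def)
  have J: "finite J" using K by (simp add: J_def)
  have "M \<ge> 0" by (simp add: M_def)
  have "{w \<in> words J n. \<bar>lazy_walk \<pi> w\<bar> > int R} \<subseteq> (\<Union>y\<in>Y. {w \<in> words J n. lazy_walk \<pi> w = y})"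
    using lazy_walk_bound unfolding J_def by (fastforce simp: Y_def abs_le_iff)
  then have "card {w \<in> words J n. \<bar>lazy_walk \<pi> w\<bar> > int R} \<le> card (\<Union>y\<in>Y. {w \<in> words J n. lazy_walk \<pi> w = y})"
    using finite_words[OF J] finY by (intro card_mono) auto
  also have "\<dots> \<le> (\<Sum>y\<in>Y. card {w \<in> words J n. lazy_walk \<pi> w = y})"
    by (rule card_UN_le[OF finY])
  finally have "real (card {w \<in> words J n. \<bar>lazy_walk \<pi> w\<bar> > int R})
      \<le> (\<Sum>y\<in>Y. real (card {w \<in> words J n. lazy_walk \<pi> w = y}))"
    by (simp flip: of_nat_sum)
  also have "\<dots> \<le> (\<Sum>y\<in>Y. exp (- \<beta> * R) * M ^ n)"
  proof (rule sum_mono)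
    fix y assume "y \<in> Y"
    then have y: "real R \<le> \<bar>real_of_int y\<bar>" by (auto simp: Y_def)
    let ?c = "real (card {w \<in> words J n. lazy_walk \<pi> w = y})"
    have "?c * exp (\<beta> * \<bar>real_of_int y\<bar>) \<le> M ^ n"
      using lazy_walk_exponential_bound[of n y \<beta>] lazy_walk_exponential_bound[of n y "- \<beta>"]
      by (auto simp: J_def M_def abs_if)
    moreover have "?c * exp (\<beta> * R) \<le> ?c * exp (\<beta> * \<bar>real_of_int y\<bar>)"
      using y assms by (intro mult_left_mono) (auto simp: mult_left_mono)
    ultimately have "?c * exp (\<beta> * R) \<le> M ^ n" by linarith
    then show "?c \<le> exp (- \<beta> * R) * M ^ n"
      by (simp add: exp_minus field_simps)
  qed
  also have "\<dots> = real (card Y) * (exp (- \<beta> * R) * M ^ n)" by simp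
  also have "\<dots> \<le> real (2 * n * D + 1) * (exp (- \<beta> * R) * M ^ n)"
  proof -
    have "card Y \<le> card {- int (n * D)..int (n * D)}"
      by (intro card_mono) (auto simp: Y_def)
    also have "\<dots> = 2 * n * D + 1" by (simp add: nat_eq_iff algebra_simps)
    finally show ?thesis
      using \<open>M \<ge> 0\<close> by (intro mult_right_mono of_nat_mono) auto
  qed
  finally show ?thesis
    by (simp add: J_def M_def power_mult_distrib card_cartesian_product mult_ac)
qed

end

text \<open>
  All suffixes of the word, that is, all intermediate positions of the walk, are controlled.
\<close>

primrec stays_within :: "nat \<Rightarrow> ('k \<Rightarrow> int \<Rightarrow> int) \<Rightarrow> (bool \<times> 'k) list \<Rightarrow> bool" where
  "stays_within R \<pi> [] = True"
| "stays_within R \<pi> (j # w) = (\<bar>lazy_walk \<pi> (j # w)\<bar> \<le> int R \<and> stays_within R \<pi> w)"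

lemma stays_within_endpoint: "stays_within R \<pi> w \<Longrightarrow> \<bar>lazy_walk \<pi> w\<bar> \<le> int R"
  by (cases w) auto

text \<open>
  A walk confined to an interval only sees the moves inside the interval.
\<close>

lemma stays_within_cong:
  assumes "\<And>k p. k \<in> K \<Longrightarrow> \<bar>p\<bar> \<le> int R \<Longrightarrow> \<pi> k p = \<pi>' k p"
    and "stays_within R \<pi> w" "set w \<subseteq> UNIV \<times> K"
  shows "lazy_walk \<pi> w = lazy_walk \<pi>' w"
  using assms(2,3)
proof (induction w)
  case (Cons j w)
  then show ?case
    using stays_within_endpoint[of R \<pi> w] assms(1) by (cases j) auto
qed simp

text \<open>
  Union bound over the \<open>n\<close> times at which the walk may be outside of the interval.
\<close>

lemma card_not_stays_within:
  assumes "finite K" "\<tau> \<ge> 0"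
    and tail: "\<And>i. i \<le> n \<Longrightarrow> real (card {w \<in> words (UNIV \<times> K) i. \<bar>lazy_walk \<pi> w\<bar> > int R})
      \<le> \<tau> * real (card (UNIV \<times> K :: (bool \<times> 'k) set)) ^ i"
  shows "real (card {w \<in> words (UNIV \<times> K) n. \<not> stays_within R \<pi> w})
    \<le> real n * \<tau> * real (card (UNIV \<times> K :: (bool \<times> 'k) set)) ^ n"
  using tail
proof (induction n)
  case (Suc n)
  define J where "J = (UNIV :: bool set) \<times> K"
  have J: "finite J" using assms by (simp add: J_def)
  let ?out = "{w \<in> words J (Suc n). \<bar>lazy_walk \<pi> w\<bar> > int R}"
  let ?prev = "{w \<in> words J (Suc n). \<not> stays_within R \<pi> (tl w)}"
  have "{w \<in> words J (Suc n). \<not> stays_within R \<pi> w} \<subseteq> ?out \<union> ?prev"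
    by (auto simp: words_def length_Suc_conv)
  then have "card {w \<in> words J (Suc n). \<not> stays_within R \<pi> w} \<le> card (?out \<union> ?prev)"
    using finite_words[OF J] by (intro card_mono) auto
  also have "\<dots> \<le> card ?out + card ?prev" by (rule card_Un_le)
  also have "card ?prev = card J * card {w \<in> words J n. \<not> stays_within R \<pi> w}"
    by (simp add: card_words_Suc[OF J])
  finally have "real (card {w \<in> words J (Suc n). \<not> stays_within R \<pi> w})
      \<le> real (card ?out) + real (card J) * real (card {w \<in> words J n. \<not> stays_within R \<pi> w})"
    by (simp flip: of_nat_mult of_nat_add)
  also have "\<dots> \<le> \<tau> * real (card J) ^ Suc n + real (card J) * (real n * \<tau> * real (card J) ^ n)"
    using Suc.prems[of "Suc n"] Suc.IH[OF Suc.prems] unfolding J_def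
    by (intro add_mono mult_left_mono) auto
  also have "\<dots> = real (Suc n) * \<tau> * real (card J) ^ Suc n"
    by (simp add: algebra_simps)
  finally show ?case by (simp add: J_def)
qed (simp add: words_0)

section \<open>Subshifts\<close>

lemma Hausdorff_subshift_topology: "Hausdorff_space (subshift_topology A X)"
  unfolding subshift_topology_def full_shift_def
  by (intro Hausdorff_space_subtopology) (simp add: Hausdorff_space_product_topology)

lemma compact_subshift_topology:
  assumes "subshift A X"
  shows "compact_space (subshift_topology A X)"
proof -
  have "compact_space (full_shift A)"
    using assms by (auto simp: full_shift_def subshift_def compact_space_product_topology
        compact_space_discrete_topology)
  then show ?thesis
    using assms unfolding subshift_topology_def subshift_def
    by (meson closedin_compact_space compact_space_subtopology)
qed

lemma subshift_value: "subshift A X \<Longrightarrow> x \<in> X \<Longrightarrow> x i \<in> A"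
  using closedin_subset[of "full_shift A" X] by (auto simp: subshift_def topspace_full_shift)

lemma shift_power_in_subshift:
  assumes "subshift A X" "x \<in> X"
  shows "shift_power k x \<in> X"
proof -
  have im: "shift ` X = X" using assms by (simp add: subshift_def)
  have fwd: "shift_power (int n) x \<in> X" for n
  proof (induction n)
    case (Suc n)
    have "shift_power (int (Suc n)) x = shift (shift_power (int n) x)"
      by (auto simp: shift_power_apply shift_def algebra_simps)
    then show ?case using Suc im by auto
  qed (use assms in \<open>simp add: shift_power_apply\<close>)
  have bwd: "shift_power (- int n) x \<in> X" for n
  proof (induction n)
    case (Suc n)
    then obtain y where y: "y \<in> X" "shift y = shift_power (- int n) x"
      using im by (metis imageE)
    have "y i = shift_power (- int (Suc n)) x i" for i
      using fun_cong[OF y(2), of "i - 1"] by (simp add: shift_def shift_power_apply algebra_simps)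
    then have "y = shift_power (- int (Suc n)) x" by blast
    then show ?case using y by simp
  qed (use assms in \<open>simp add: shift_power_apply\<close>)
  show ?thesis
    using fwd[of "nat k"] bwd[of "nat (- k)"] by (cases "k \<ge> 0") auto
qed

lemma shift_power_inj_if_aperiodic:
  assumes "\<not> periodic_point x" "shift_power p x = shift_power q x"
  shows "p = q"
proof -
  have *: False if "p < q" "shift_power p x = shift_power q x" for p q
  proof -
    have "x i = x (i + (q - p))" for i
      using fun_cong[OF that(2), of "i - p"] by (simp add: shift_power_apply algebra_simps)
    then have "(shift ^^ nat (q - p)) x = x"
      using that by (auto simp: shift_funpow)
    then show False
      using assms(1) that(1) unfolding periodic_point_def by (metis zero_less_nat_eq diff_gt_0_iff_gt)
  qed
  show ?thesis using *[of p q] *[of q p] assms(2) by (cases p q rule: linorder_cases) auto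
qed

lemma openin_cylinder:
  assumes "subshift A X" "x \<in> X"
  shows "openin (subshift_topology A X) {y \<in> X. \<forall>i. \<bar>i\<bar> \<le> int m \<longrightarrow> x i = y i}"
proof -
  let ?U = "PiE UNIV (\<lambda>i. if \<bar>i\<bar> \<le> int m then {x i} else A)"
  have "openin (full_shift A) ?U"
    unfolding full_shift_def openin_PiE_gen
  proof (intro disjI2 conjI ballI)
    have "{i \<in> UNIV. (if \<bar>i\<bar> \<le> int m then {x i} else A) \<noteq> topspace (discrete_topology A)}
        \<subseteq> {- int m..int m}"
      by (auto split: if_splits)
    then show "finite {i \<in> UNIV. (if \<bar>i\<bar> \<le> int m then {x i} else A) \<noteq> topspace (discrete_topology A)}"
      by (rule finite_subset) simp
  qed (use assms subshift_value in auto)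
  then have "openin (subshift_topology A X) (X \<inter> ?U)"
    unfolding subshift_topology_def by (metis openin_subtopology_Int2)
  also have "X \<inter> ?U = {y \<in> X. \<forall>i. \<bar>i\<bar> \<le> int m \<longrightarrow> x i = y i}"
    using assms subshift_value[OF assms(1)] by (force simp: PiE_iff split: if_splits)
  finally show ?thesis .
qed

lemma open_set_contains_cylinder:
  assumes "subshift A X" "openin (subshift_topology A X) V" "x \<in> V"
  obtains m where "\<And>y. y \<in> X \<Longrightarrow> (\<forall>i. \<bar>i\<bar> \<le> int m \<longrightarrow> x i = y i) \<Longrightarrow> y \<in> V"
proof -
  obtain W where W: "openin (full_shift A) W" "V = W \<inter> X"
    using assms(2) by (auto simp: subshift_topology_def openin_subtopology)
  then obtain U where U: "finite {i. U i \<noteq> A}" "x \<in> PiE UNIV U" "PiE UNIV U \<subseteq> W"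
    using assms(3) unfolding full_shift_def openin_product_topology_alt by fastforce
  define m where "m = nat (Max (insert 0 (abs ` {i. U i \<noteq> A})))"
  have m: "\<bar>i\<bar> \<le> int m" if "U i \<noteq> A" for i
    using U(1) that by (simp add: m_def)
  show ?thesis
  proof
    fix y assume y: "y \<in> X" "\<forall>i. \<bar>i\<bar> \<le> int m \<longrightarrow> x i = y i"
    have "y i \<in> U i" for i
    proof (cases "U i = A")
      case True
      then show ?thesis using y assms(1) subshift_value by auto
    next
      case False
      then show ?thesis using y(2) m[OF False] U(2) by (metis PiE_E UNIV_I)
    qed
    then show "y \<in> V" using U(3) W(2) y(1) by (auto simp: PiE_iff)
  qed
qed

text \<open>
  Compactness turns the pointwise local constancy of a continuous integer valued function into
  dependence on a single finite window of coordinates.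
\<close>

lemma continuous_integer_function_window:
  fixes k :: "(int \<Rightarrow> 'a) \<Rightarrow> int"
  assumes sub: "subshift A X"
    and k: "continuous_map (subshift_topology A X) (discrete_topology UNIV) k"
  obtains m D where "\<And>x y. x \<in> X \<Longrightarrow> y \<in> X \<Longrightarrow> (\<forall>i. \<bar>i\<bar> \<le> int m \<longrightarrow> x i = y i) \<Longrightarrow> k x = k y"
    and "\<And>x. x \<in> X \<Longrightarrow> \<bar>k x\<bar> \<le> int D"
proof -
  note top = topspace_subshift_topology[OF sub]
  have "\<exists>m. \<forall>y\<in>X. (\<forall>i. \<bar>i\<bar> \<le> int m \<longrightarrow> x i = y i) \<longrightarrow> k y = k x" if x: "x \<in> X" for x
  proof -
    have "openin (subshift_topology A X) {y \<in> topspace (subshift_topology A X). k y \<in> {k x}}"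
      using k by (rule openin_continuous_map_preimage) simp
    then show ?thesis
      using open_set_contains_cylinder[OF sub, of _ x] x unfolding top
      by (metis (mono_tags, lifting) mem_Collect_eq singleton_iff)
  qed
  then obtain M where M: "\<And>x y. x \<in> X \<Longrightarrow> y \<in> X \<Longrightarrow> (\<forall>i. \<bar>i\<bar> \<le> int (M x) \<longrightarrow> x i = y i) \<Longrightarrow> k y = k x"
    by metis
  define C where "C x = {y \<in> X. \<forall>i. \<bar>i\<bar> \<le> int (M x) \<longrightarrow> x i = y i}" for x
  have "\<exists>\<F>. finite \<F> \<and> \<F> \<subseteq> C ` X \<and> X \<subseteq> \<Union> \<F>"
    using compact_subshift_topology[OF sub] unfolding compact_space_alt top
    by (rule allE[of _ "C ` X"]) (auto simp: C_def intro: openin_cylinder[OF sub])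
  then obtain Z where Z: "finite Z" "Z \<subseteq> X" "X \<subseteq> (\<Union>z\<in>Z. C z)"
    by (metis finite_subset_image)
  define m where "m = Max (insert 0 (M ` Z))"
  define D where "D = nat (Max (insert 0 ((\<lambda>z. \<bar>k z\<bar>) ` Z)))"
  have m: "M z \<le> m" and D: "\<bar>k z\<bar> \<le> int D" if "z \<in> Z" for z
    using Z(1) that by (auto simp: m_def D_def)
  show ?thesis
  proof
    fix x assume x: "x \<in> X"
    then obtain z where z: "z \<in> Z" "x \<in> C z" using Z(3) by blast
    then have kx: "k x = k z" using M[of z x] Z(2) by (auto simp: C_def)
    then show "\<bar>k x\<bar> \<le> int D" using D[OF z(1)] by simp
    fix y assume y: "y \<in> X" "\<forall>i. \<bar>i\<bar> \<le> int m \<longrightarrow> x i = y i"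
    then have "\<forall>i. \<bar>i\<bar> \<le> int (M z) \<longrightarrow> z i = y i"
      using z(2) m[OF z(1)] by (auto simp: C_def)
    then show "k x = k y" using M[of z y] z(1) Z(2) y(1) kx by auto
  qed
qed

text \<open>
  A point of period \<open>p\<close> is determined by \<open>p\<close> consecutive letters.
\<close>

lemma finite_points_of_period:
  assumes sub: "subshift A X" and "p > 0"
  shows "finite {x \<in> X. (shift ^^ p) x = x}"
proof -
  let ?P = "{x \<in> X. (shift ^^ p) x = x}"
  have mod: "x i = x (i mod int p)" if "x \<in> ?P" for x i
  proof -
    have "(shift ^^ p) x = x" using that by blast
    then have "x (i + int p) = x i" for i
      unfolding shift_funpow by (rule fun_cong)
    then interpret periodic_fun_simple x "int p" by unfold_locales
    have "x (i mod int p + of_int (i div int p) * int p) = x (i mod int p)" by (rule plus_of_int)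
    then show ?thesis by simp
  qed
  have "inj_on (\<lambda>x. restrict x {0..<int p}) ?P"
  proof (rule inj_onI, rule ext)
    fix x y i assume xy: "x \<in> ?P" "y \<in> ?P" and eq: "restrict x {0..<int p} = restrict y {0..<int p}"
    have "i mod int p \<in> {0..<int p}" using \<open>p > 0\<close> by simp
    then have "x (i mod int p) = y (i mod int p)" using fun_cong[OF eq, of "i mod int p"] by simp
    then show "x i = y i" using mod[OF xy(1), of i] mod[OF xy(2), of i] by simp
  qed
  moreover have "(\<lambda>x. restrict x {0..<int p}) ` ?P \<subseteq> {0..<int p} \<rightarrow>\<^sub>E A"
    using subshift_value[OF sub] by auto
  moreover have "finite ({0..<int p} \<rightarrow>\<^sub>E A)"
    using sub by (intro finite_PiE) (auto simp: subshift_def)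
  ultimately show ?thesis by (meson finite_imageD finite_subset)
qed

text \<open>
  Baire category: the points of a given period form a finite closed set. If it had an interior point,
  this point would be isolated, so it is nowhere dense, and a countable union of such sets has empty
  interior.
\<close>

lemma aperiodic_points_dense:
  assumes sub: "subshift A X" and iso: "without_isolated_periodic_points A X"
  shows "Abstract_Topology.closure_of (subshift_topology A X) {x \<in> X. \<not> periodic_point x} = X"
proof -
  let ?T = "subshift_topology A X"
  let ?P = "\<lambda>p. {x \<in> X. (shift ^^ Suc p) x = x}"
  note top = topspace_subshift_topology[OF sub]
  have fin: "finite (?P p)" for p using finite_points_of_period[OF sub, of "Suc p"] by simp
  have fin_closed: "closedin ?T S" if "finite S" "S \<subseteq> X" for S
    using that Hausdorff_subshift_topology top by (metis closedin_Hausdorff_finite)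
  have "?T interior_of (\<Union>(range ?P)) = {}"
  proof (rule Baire_category_alt)
    show "completely_metrizable_space ?T \<or> locally_compact_space ?T \<and> regular_space ?T"
      using compact_subshift_topology[OF sub] Hausdorff_subshift_topology
      by (metis compact_imp_locally_compact_space compact_Hausdorff_imp_regular_space)
    fix S assume "S \<in> range ?P"
    then obtain p where S: "S = ?P p" by blast
    have "x \<notin> ?T interior_of S" for x
    proof
      assume x: "x \<in> ?T interior_of S"
      have sub': "?T interior_of S \<subseteq> S" by (rule interior_of_subset)
      then have "finite (?T interior_of S)" using fin S finite_subset by blast
      then have "closedin ?T (?T interior_of S - {x})"
        using sub' S by (intro fin_closed) auto
      then have "openin ?T (?T interior_of S - (?T interior_of S - {x}))"
        by (intro openin_diff) auto
      moreover have "?T interior_of S - (?T interior_of S - {x}) = {x}" using x by blast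
      moreover have "x \<in> X" "periodic_point x"
        using x sub' S unfolding periodic_point_def by blast+
      ultimately show False using iso unfolding without_isolated_periodic_points_def by auto
    qed
    then show "closedin ?T S \<and> ?T interior_of S = {}"
      using fin_closed[OF fin] S by auto
  qed auto
  then have "Abstract_Topology.closure_of ?T (X - \<Union>(range ?P)) = X"
    using closure_of_complement[of ?T "\<Union>(range ?P)"] top by simp
  also have "X - \<Union>(range ?P) = {x \<in> X. \<not> periodic_point x}"
    unfolding periodic_point_def using gr0_conv_Suc by fastforce
  finally show ?thesis .
qed

lemma aperiodic_point_in_cylinder:
  assumes "subshift A X" "without_isolated_periodic_points A X" "x \<in> X"
  obtains y where "y \<in> X" "\<not> periodic_point y" "\<And>i. \<bar>i\<bar> \<le> int m \<Longrightarrow> y i = x i"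
proof -
  let ?C = "{y \<in> X. \<forall>i. \<bar>i\<bar> \<le> int m \<longrightarrow> x i = y i}"
  have "x \<in> Abstract_Topology.closure_of (subshift_topology A X) {x \<in> X. \<not> periodic_point x}"
    using aperiodic_points_dense[OF assms(1,2)] assms(3) by simp
  moreover have "openin (subshift_topology A X) ?C" "x \<in> ?C"
    using openin_cylinder[OF assms(1,3)] assms(3) by auto
  ultimately obtain y where "y \<in> ?C" "y \<in> {x \<in> X. \<not> periodic_point x}"
    unfolding in_closure_of by meson
  then show ?thesis using that by auto
qed

section \<open>Choice of the time and of the window\<close>

text \<open>
  The radius \<open>R\<close> is about \<open>sqrt (20 * D\<^sup>2 * n * ln n)\<close>. The Gaussian factor is then at most
  \<open>n ^ (- 5)\<close>, which beats all the polynomial factors of the union bound, since the number of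
  windows of length \<open>N = 2 * (R + m) + 1\<close> is eventually at most \<open>n\<^sup>2\<close>. On the other hand, \<open>N\<^sup>2\<close>
  is at most \<open>100 * D\<^sup>2 * n * ln n\<close> and \<open>ln N\<close> is at least \<open>ln n / 2\<close>, so the hypothesis on \<open>\<rho>\<close> gives
  \<open>\<rho> N = o (n / ln n)\<close>, and \<open>(2 * R + 1) ^ \<rho> N\<close> grows subexponentially in \<open>n\<close>.
\<close>

lemma time_and_radius_exist:
  fixes \<rho> :: "nat \<Rightarrow> nat" and c :: real
  assumes lim: "(\<lambda>n. (ln (real n) / real n)\<^sup>2 * real (\<rho> n)) \<longlonglongrightarrow> 0"
    and D: "D > 0" and c: "c > 0"
  obtains n R :: nat where "n > 0" "R \<le> 2 * D * n"
    "2 * real n * real (2 * n * D + 1) * exp (- ((real R)\<^sup>2 / (4 * (real D)\<^sup>2 * real n)))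
      * real (\<rho> (2 * (R + m) + 1)) \<le> 1"
    "4 * real (2 * R + 1) ^ \<rho> (2 * (R + m) + 1) < exp (c * real n)"
proof -
  define a where "a = real D"
  have a: "a > 0" using D by (simp add: a_def)
  define \<mu> where "\<mu> = real m"
  have \<mu>: "\<mu> \<ge> 0" by (simp add: \<mu>_def)
  define r where "r n = sqrt (20 * a\<^sup>2 * (n * ln n))" for n :: real
  define R where "R n = nat \<lceil>r (real n)\<rceil>" for n :: nat
  define N where "N n = 2 * (R n + m) + 1" for n
  define \<epsilon> where "\<epsilon> = c / (1000 * a\<^sup>2)"
  have \<epsilon>: "\<epsilon> > 0" using a c by (simp add: \<epsilon>_def)
  have r_top: "filterlim (\<lambda>n::nat. r (real n)) at_top sequentially"
    unfolding r_def using a by real_asymp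
  then have "filterlim (\<lambda>n. real (N n)) at_top sequentially"
    by (rule filterlim_at_top_mono) (auto simp: N_def R_def intro!: always_eventually, linarith)
  then have "filterlim N at_top sequentially"
    by (simp add: filterlim_at_top eventually_sequentially) (metis of_nat_le_iff)
  then have "eventually (\<lambda>n. (ln (real (N n)) / real (N n))\<^sup>2 * real (\<rho> (N n)) < \<epsilon>) sequentially"
    using order_tendstoD(2)[OF lim \<epsilon>] by (rule eventually_compose_filterlim[rotated])
  moreover have "eventually (\<lambda>n::nat. sqrt (real n) \<le> r (real n)) sequentially"
    unfolding r_def using a by real_asymp
  moreover have "eventually (\<lambda>n::nat. r (real n) + 1 \<le> 2 * a * real n) sequentially"
    unfolding r_def using a by real_asymp
  moreover have "eventually (\<lambda>n::nat. 2 * (r (real n) + 1 + \<mu>) + 1 \<le> real n) sequentially"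
    unfolding r_def using a by real_asymp
  moreover have "eventually (\<lambda>n::nat. 5 * (3 + 2 * \<mu>) \<le> r (real n)) sequentially"
    using r_top by (simp add: filterlim_at_top)
  moreover have "eventually (\<lambda>n::nat. 2 * real n * (2 * real n * a + 1) * (real n)\<^sup>2 \<le> real n ^ 5) sequentially"
    using a by real_asymp
  moreover have "eventually (\<lambda>n::nat. ln 4 < c * real n / 2) sequentially"
    using c by real_asymp
  moreover have "eventually (\<lambda>n::nat. c * real n / ln (real n) \<le> (real n)\<^sup>2) sequentially"
    using c by real_asymp
  moreover have "eventually (\<lambda>n::nat. n \<ge> 3) sequentially" by (rule eventually_ge_at_top)
  ultimately have "eventually (\<lambda>n. (ln (real (N n)) / real (N n))\<^sup>2 * real (\<rho> (N n)) < \<epsilon> \<and>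
      sqrt (real n) \<le> r (real n) \<and> r (real n) + 1 \<le> 2 * a * real n \<and>
      2 * (r (real n) + 1 + \<mu>) + 1 \<le> real n \<and>
      5 * (3 + 2 * \<mu>) \<le> r (real n) \<and>
      2 * real n * (2 * real n * a + 1) * (real n)\<^sup>2 \<le> real n ^ 5 \<and>
      ln 4 < c * real n / 2 \<and> c * real n / ln (real n) \<le> (real n)\<^sup>2 \<and> n \<ge> 3) sequentially"
    by eventually_elim blast
  then obtain n where n: "n \<ge> 3"
    and \<rho>_lim: "(ln (real (N n)) / real (N n))\<^sup>2 * real (\<rho> (N n)) < \<epsilon>"
    and r_sqrt: "sqrt (real n) \<le> r (real n)"
    and r_lin: "r (real n) + 1 \<le> 2 * a * real n"
    and r_n: "2 * (r (real n) + 1 + \<mu>) + 1 \<le> real n"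
    and r_large: "5 * (3 + 2 * \<mu>) \<le> r (real n)"
    and poly: "2 * real n * (2 * real n * a + 1) * (real n)\<^sup>2 \<le> real n ^ 5"
    and c_lin: "ln 4 < c * real n / 2"
    and c_sq: "c * real n / ln (real n) \<le> (real n)\<^sup>2"
    unfolding eventually_sequentially by (metis order_refl)
  have ln_n: "ln (real n) > 0" using n by simp
  have "0 \<le> r (real n)" using ln_n a by (simp add: r_def)
  then have R: "r (real n) \<le> real (R n)" "real (R n) \<le> r (real n) + 1"
    by (simp_all add: R_def)
  have N: "real (N n) \<le> 2 * (r (real n) + 1 + \<mu>) + 1" "r (real n) \<le> real (N n)" "N n > 0"
    using R \<mu> \<open>0 \<le> r (real n)\<close> by (auto simp: N_def \<mu>_def)
  have N_n: "real (N n) \<le> real n" using N(1) r_n by linarith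
  have "ln (real n) / 2 = ln (sqrt (real n))"
    using n by (simp add: ln_sqrt)
  also have "\<dots> \<le> ln (real (N n))"
    using n r_sqrt N by (subst ln_le_cancel_iff) auto
  finally have ln_N: "ln (real n) / 2 \<le> ln (real (N n))" .
  have "real (N n) \<le> 11 / 5 * r (real n)"
    using N(1) r_large by (simp add: field_simps)
  then have "(real (N n))\<^sup>2 \<le> (11 / 5 * r (real n))\<^sup>2"
    by (intro power_mono) auto
  also have "\<dots> = 484 / 5 * a\<^sup>2 * (real n * ln (real n))"
    using ln_n by (simp add: r_def power_mult_distrib power2_eq_square)
  also have "\<dots> \<le> 100 * a\<^sup>2 * (real n * ln (real n))"
    using ln_n by (intro mult_right_mono) auto
  finally have N_sq: "(real (N n))\<^sup>2 \<le> 100 * a\<^sup>2 * (real n * ln (real n))" .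
  have "(ln (real n) / 2)\<^sup>2 * real (\<rho> (N n)) \<le> (ln (real (N n)))\<^sup>2 * real (\<rho> (N n))"
    using ln_N ln_n by (intro mult_right_mono power_mono) auto
  also have "\<dots> \<le> \<epsilon> * (real (N n))\<^sup>2"
    using \<rho>_lim N(3) by (simp add: power_divide field_simps)
  also have "\<dots> \<le> \<epsilon> * (100 * a\<^sup>2 * (real n * ln (real n)))"
    using N_sq \<epsilon> by (intro mult_left_mono) auto
  also have "\<dots> = c / 10 * real n * ln (real n)"
    using a by (simp add: \<epsilon>_def)
  finally have "(ln (real n) * real (\<rho> (N n))) * ln (real n) \<le> (c * 4 / 10 * real n) * ln (real n)"
    by (simp add: power2_eq_square mult_ac)
  then have \<rho>_ln: "ln (real n) * real (\<rho> (N n)) \<le> c * 4 / 10 * real n"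
    using ln_n by (rule mult_right_le_imp_le)
  then have "real (\<rho> (N n)) \<le> c * 4 / 10 * real n / ln (real n)"
    using ln_n by (simp add: field_simps)
  also have "\<dots> \<le> c * real n / ln (real n)"
    using ln_n c by (intro divide_right_mono) auto
  also note c_sq
  finally have \<rho>_sq: "real (\<rho> (N n)) \<le> (real n)\<^sup>2" .
  show ?thesis
  proof
    show "n > 0" using n by simp
    have "real (R n) \<le> real (2 * D * n)" using R r_lin by (simp add: a_def)
    then show "R n \<le> 2 * D * n" by (simp only: of_nat_le_iff)
    have "20 * a\<^sup>2 * (real n * ln (real n)) = (r (real n))\<^sup>2"
      using ln_n by (simp add: r_def)
    also have "\<dots> \<le> (real (R n))\<^sup>2" using R \<open>0 \<le> r (real n)\<close> by (intro power_mono)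
    finally have "5 * ln (real n) \<le> (real (R n))\<^sup>2 / (4 * (real D)\<^sup>2 * real n)"
      using n D by (simp add: a_def field_simps)
    then have "exp (- ((real (R n))\<^sup>2 / (4 * (real D)\<^sup>2 * real n))) \<le> exp (- (5 * ln (real n)))"
      by simp
    also have "\<dots> = 1 / real n ^ 5"
      using exp_of_nat_mult[of 5 "ln (real n)"] n by (simp add: exp_minus inverse_eq_divide)
    finally have e: "exp (- ((real (R n))\<^sup>2 / (4 * (real D)\<^sup>2 * real n))) \<le> 1 / real n ^ 5" .
    have "2 * real n * real (2 * n * D + 1) * exp (- ((real (R n))\<^sup>2 / (4 * (real D)\<^sup>2 * real n)))
      * real (\<rho> (2 * (R n + m) + 1)) \<le> 2 * real n * real (2 * n * D + 1) * (1 / real n ^ 5) * (real n)\<^sup>2"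
      using e \<rho>_sq by (intro mult_mono) (auto simp: N_def)
    also have "\<dots> \<le> 1" using poly n by (simp add: a_def field_simps)
    finally show "2 * real n * real (2 * n * D + 1) * exp (- ((real (R n))\<^sup>2 / (4 * (real D)\<^sup>2 * real n)))
      * real (\<rho> (2 * (R n + m) + 1)) \<le> 1" .
    have "real (2 * R n + 1) ^ \<rho> (N n) \<le> real n ^ \<rho> (N n)"
      using N_n by (intro power_mono) (auto simp: N_def)
    also have "\<dots> = exp (ln (real n) * real (\<rho> (N n)))"
      using n by (simp add: exp_of_nat2_mult)
    also have "\<dots> \<le> exp (c * real n / 2)"
    proof -
      have "0 \<le> c * real n" using c by simp
      then show ?thesis unfolding exp_le_cancel_iff using \<rho>_ln by linarith
    qed
    finally have "4 * real (2 * R n + 1) ^ \<rho> (N n) \<le> 4 * exp (c * real n / 2)" by simp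
    also have "\<dots> = exp (ln 4) * exp (c * real n / 2)" by simp
    also have "\<dots> < exp (c * real n / 2) * exp (c * real n / 2)"
      using c_lin by (intro mult_strict_right_mono) (simp_all only: exp_less_cancel_iff exp_gt_zero)
    also have "\<dots> = exp (c * real n)" by (simp flip: exp_add)
    finally show "4 * real (2 * R n + 1) ^ \<rho> (2 * (R n + m) + 1) < exp (c * real n)"
      by (simp add: N_def)
  qed
qed

section \<open>Words in the topological full group\<close>

lemma group_element_apply:
  fixes A X
  defines "G \<equiv> topological_full_group A X"
  assumes sub: "subshift A X" and g: "g \<in> carrier G"
  shows full_group_apply_mult: "h \<in> carrier G \<Longrightarrow> x \<in> X \<Longrightarrow> (g \<otimes>\<^bsub>G\<^esub> h) x = g (h x)"
    and full_group_apply_inv: "x \<in> X \<Longrightarrow> (inv\<^bsub>G\<^esub> g) (g x) = x"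
proof -
  interpret group G unfolding G_def using sub by (rule group_topological_full_group)
  have Bij: "f \<in> Bij X" if "f \<in> carrier G" for f
    using that by (simp add: G_def topological_full_group_def full_group_elements_def)
  have mult: "(f \<otimes>\<^bsub>G\<^esub> h) x = f (h x)" if "f \<in> carrier G" "h \<in> carrier G" "x \<in> X" for f h x
    using Bij[OF that(1)] Bij[OF that(2)] that(3)
    by (simp add: G_def topological_full_group_def BijGroup_def compose_def)
  show "(g \<otimes>\<^bsub>G\<^esub> h) x = g (h x)" if "h \<in> carrier G" "x \<in> X" for h x
    using mult g that by blast
  show "(inv\<^bsub>G\<^esub> g) (g x) = x" if "x \<in> X" for x
    using mult[OF inv_closed[OF g] g that] l_inv[OF g] that
    by (simp add: G_def topological_full_group_def BijGroup_def)
qed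

lemma full_group_one_apply: "x \<in> X \<Longrightarrow> \<one>\<^bsub>topological_full_group A X\<^esub> x = x"
  by (simp add: topological_full_group_def BijGroup_def)

text \<open>
  Two continuous maps into a Hausdorff space that agree on a dense set are equal; outside of \<open>X\<close> both
  are \<open>undefined\<close>.
\<close>

lemma full_group_element_determined_by_aperiodic_points:
  assumes sub: "subshift A X" and iso: "without_isolated_periodic_points A X"
    and g: "g \<in> carrier (topological_full_group A X)" and h: "h \<in> carrier (topological_full_group A X)"
    and eq: "\<And>x. x \<in> X \<Longrightarrow> \<not> periodic_point x \<Longrightarrow> g x = h x"
  shows "g = h"
proof -
  let ?T = "subshift_topology A X"
  have cont: "continuous_map ?T ?T f" and ext: "f \<in> extensional X"
    if "f \<in> carrier (topological_full_group A X)" for f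
    using that by (auto simp: topological_full_group_def full_group_elements_def Bij_def
        intro: homeomorphic_imp_continuous_map)
  have "g x = h x" if "x \<in> X" for x
  proof (rule forall_in_closure_of_eq[OF _ Hausdorff_subshift_topology cont[OF g] cont[OF h]])
    show "x \<in> Abstract_Topology.closure_of ?T {x \<in> X. \<not> periodic_point x}"
      using that aperiodic_points_dense[OF sub iso] by simp
  qed (use eq in blast)
  then show ?thesis using ext[OF g] ext[OF h] by (intro extensionalityI[of _ X]) auto
qed

text \<open>
  A finite symmetric set \<open>K\<close> in the full group, with chosen displacements \<open>\<kappa> g\<close> that depend on the
  coordinates in \<open>{- m..m}\<close> only and are bounded by \<open>D\<close>.
\<close>

locale full_group_words =
  fixes A :: "'a set" and X :: "(int \<Rightarrow> 'a) set"
    and K :: "((int \<Rightarrow> 'a) \<Rightarrow> int \<Rightarrow> 'a) set"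
    and \<kappa> :: "((int \<Rightarrow> 'a) \<Rightarrow> int \<Rightarrow> 'a) \<Rightarrow> (int \<Rightarrow> 'a) \<Rightarrow> int" and m D :: nat
  assumes sub: "subshift A X" and iso: "without_isolated_periodic_points A X"
    and K: "finite K" "K \<subseteq> carrier (topological_full_group A X)"
    and K_inv: "\<And>g. g \<in> K \<Longrightarrow> inv\<^bsub>topological_full_group A X\<^esub> g \<in> K"
    and cocycle: "\<And>g x. g \<in> K \<Longrightarrow> x \<in> X \<Longrightarrow> g x = shift_power (\<kappa> g x) x"
    and window: "\<And>g x y. g \<in> K \<Longrightarrow> x \<in> X \<Longrightarrow> y \<in> X \<Longrightarrow> (\<forall>i. \<bar>i\<bar> \<le> int m \<longrightarrow> x i = y i) \<Longrightarrow> \<kappa> g x = \<kappa> g y"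
    and bound: "\<And>g x. g \<in> K \<Longrightarrow> x \<in> X \<Longrightarrow> \<bar>\<kappa> g x\<bar> \<le> int D"
    and D_pos: "D > 0"
begin

abbreviation G where "G \<equiv> topological_full_group A X"

abbreviation "J \<equiv> (UNIV :: bool set) \<times> K"

sublocale group G using sub by (rule group_topological_full_group)

definition letter :: "bool \<times> ((int \<Rightarrow> 'a) \<Rightarrow> int \<Rightarrow> 'a) \<Rightarrow> (int \<Rightarrow> 'a) \<Rightarrow> int \<Rightarrow> 'a"
  where "letter = (\<lambda>(b, g). if b then g else \<one>\<^bsub>G\<^esub>)"

text \<open>
  The action of \<open>g\<close> on the orbit of \<open>x\<close>, in the coordinate \<open>p\<close> of the orbit point
  \<open>shift_power p x\<close>.
\<close>

definition orbit_step :: "(int \<Rightarrow> 'a) \<Rightarrow> ((int \<Rightarrow> 'a) \<Rightarrow> int \<Rightarrow> 'a) \<Rightarrow> int \<Rightarrow> int"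
  where "orbit_step x g p = p + \<kappa> g (shift_power p x)"

lemma finite_J: "finite J" using K by simp

lemma letter_closed: "j \<in> J \<Longrightarrow> letter j \<in> carrier G"
  using K by (auto simp: letter_def)

lemma apply_shift_power:
  assumes "g \<in> K" "x \<in> X"
  shows "g (shift_power p x) = shift_power (orbit_step x g p) x"
  using cocycle[OF assms(1) shift_power_in_subshift[OF sub assms(2)], of p]
  by (simp add: orbit_step_def add.commute flip: shift_power_add)

text \<open>
  On an aperiodic orbit the coordinate is unique, so the bounded moves of \<open>\<int>\<close> really define an action
  there and the walk on the orbit is symmetric. On a periodic orbit the chosen displacements of \<open>g\<close> and
  of its inverse might not be opposite.
\<close>

lemma orbit_step_inv:
  assumes "x \<in> X" "\<not> periodic_point x" "g \<in> K"
  shows "orbit_step x (inv\<^bsub>G\<^esub> g) (orbit_step x g p) = p"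
proof (rule shift_power_inj_if_aperiodic[OF assms(2)])
  have "shift_power (orbit_step x (inv\<^bsub>G\<^esub> g) (orbit_step x g p)) x = (inv\<^bsub>G\<^esub> g) (g (shift_power p x))"
    using apply_shift_power assms(1,3) K_inv by simp
  also have "\<dots> = shift_power p x"
    using full_group_apply_inv[OF sub _ shift_power_in_subshift[OF sub assms(1)]] assms(3) K(2) by blast
  finally show "shift_power (orbit_step x (inv\<^bsub>G\<^esub> g) (orbit_step x g p)) x = shift_power p x" .
qed

lemma word_prod_apply:
  assumes "x \<in> X" "set w \<subseteq> J"
  shows "word_prod letter w x = shift_power (lazy_walk (orbit_step x) w) x"
  using assms(2)
proof (induction w)
  case Nil
  then show ?case
    using full_group_one_apply[OF assms(1)] by (simp add: word_prod_def shift_power_apply)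
next
  case (Cons j w)
  then have closed: "letter j \<in> carrier G" "word_prod letter w \<in> carrier G"
    using letter_closed word_prod_closed[of w J letter] by auto
  have "word_prod letter (j # w) = letter j \<otimes>\<^bsub>G\<^esub> word_prod letter w"
    by (simp add: word_prod_def)
  then have step: "word_prod letter (j # w) x = letter j (shift_power (lazy_walk (orbit_step x) w) x)"
    using full_group_apply_mult[OF sub closed assms(1)] Cons by simp
  obtain b g where j: "j = (b, g)" "g \<in> K" using Cons.prems by auto
  show ?case
  proof (cases b)
    case True
    then show ?thesis using step j apply_shift_power assms(1) by (simp add: letter_def)
  next
    case False
    then show ?thesis
      using step j full_group_one_apply[OF shift_power_in_subshift[OF sub assms(1)]]
      by (simp add: letter_def)
  qed
qed

text \<open>
  While the walk stays in \<open>{- R..R}\<close>, the displacements it uses are read from coordinates in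
  \<open>{- (R + m)..R + m}\<close>.
\<close>

lemma lazy_walk_determined_by_window:
  assumes "x \<in> X" "y \<in> X" and agree: "\<forall>i. \<bar>i\<bar> \<le> int (R + m) \<longrightarrow> x i = y i"
    and "stays_within R (orbit_step x) w" "set w \<subseteq> J"
  shows "lazy_walk (orbit_step x) w = lazy_walk (orbit_step y) w"
proof (rule stays_within_cong[OF _ assms(4,5)])
  fix g p assume g: "g \<in> K" and p: "\<bar>p\<bar> \<le> int R"
  have "\<forall>i. \<bar>i\<bar> \<le> int m \<longrightarrow> shift_power p x i = shift_power p y i"
    using agree p by (auto simp: shift_power_apply)
  then show "orbit_step x g p = orbit_step y g p"
    using window[OF g shift_power_in_subshift[OF sub assms(1)] shift_power_in_subshift[OF sub assms(2)]]
    by (simp add: orbit_step_def)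
qed

text \<open>
  The entropy count. If the walks started at one representative of every window stay confined, then
  the product of the word is determined by their endpoints: every point has the same walk as the
  representative of its own window. Each of the \<open>complexity X N\<close> endpoints takes at most \<open>2 * R + 1\<close>
  values.
\<close>

lemma few_word_products_with_confined_orbits:
  assumes rep: "\<And>v. v \<in> subshift_words X (2 * (R + m) + 1) \<Longrightarrow> rep v \<in> X \<and>
      (\<forall>i < 2 * (R + m) + 1. rep v (int i - int (R + m)) = v ! i)"
    and W: "W \<subseteq> words J n"
    and stays: "\<And>w v. w \<in> W \<Longrightarrow> v \<in> subshift_words X (2 * (R + m) + 1) \<Longrightarrow>
      stays_within R (orbit_step (rep v)) w"
  shows "card (word_prod letter ` W) \<le> (2 * R + 1) ^ complexity X (2 * (R + m) + 1)"
proof -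
  define N where "N = 2 * (R + m) + 1"
  define V where "V = subshift_words X N"
  define \<psi> where "\<psi> w = (\<lambda>v\<in>V. lazy_walk (orbit_step (rep v)) w)" for w
  have finV: "finite V" unfolding V_def using sub by (rule finite_subshift_words)
  have setW: "set w \<subseteq> J" if "w \<in> W" for w using that W by (auto simp: words_def)
  have finW: "finite W" using W finite_words[OF finite_J] finite_subset by blast
  have position: "\<exists>v\<in>V. \<forall>w\<in>W. lazy_walk (orbit_step x) w = \<psi> w v" if x: "x \<in> X" for x
  proof -
    define v where "v = map (\<lambda>i. x (int i - int (R + m))) [0..<N]"
    have v: "v \<in> V"
      unfolding V_def subshift_words_def using x
      by (auto simp: v_def algebra_simps intro!: bexI[of _ x] exI[of _ "- int (R + m)"])
    have agree: "\<forall>i. \<bar>i\<bar> \<le> int (R + m) \<longrightarrow> rep v i = x i"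
    proof (intro allI impI)
      fix i assume i: "\<bar>i\<bar> \<le> int (R + m)"
      define l where "l = nat (i + int (R + m))"
      have l: "l < N" "i = int l - int (R + m)" using i by (auto simp: l_def N_def)
      then have "rep v i = v ! l" using rep[of v] v by (auto simp: V_def N_def)
      also have "\<dots> = x i" using l by (simp add: v_def)
      finally show "rep v i = x i" .
    qed
    have "lazy_walk (orbit_step x) w = \<psi> w v" if "w \<in> W" for w
      using lazy_walk_determined_by_window[OF _ x agree stays[OF that] setW[OF that]] rep v
      by (simp add: \<psi>_def V_def N_def)
    then show ?thesis using v by blast
  qed
  have determined: "word_prod letter w = word_prod letter w'" if "w \<in> W" "w' \<in> W" "\<psi> w = \<psi> w'" for w w'
  proof (rule full_group_element_determined_by_aperiodic_points[OF sub iso])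
    show "word_prod letter w \<in> carrier G" "word_prod letter w' \<in> carrier G"
      using word_prod_closed[OF setW letter_closed] that by auto
    fix x assume x: "x \<in> X"
    then have "lazy_walk (orbit_step x) w = lazy_walk (orbit_step x) w'"
      using position[OF x] that by auto
    then show "word_prod letter w x = word_prod letter w' x"
      using word_prod_apply[OF x] setW that by simp
  qed
  have "word_prod letter ` W \<subseteq> (\<lambda>f. word_prod letter (inv_into W \<psi> f)) ` (\<psi> ` W)"
  proof
    fix g assume "g \<in> word_prod letter ` W"
    then obtain w where w: "w \<in> W" "g = word_prod letter w" by blast
    then have "inv_into W \<psi> (\<psi> w) \<in> W" "\<psi> (inv_into W \<psi> (\<psi> w)) = \<psi> w"
      by (auto simp: inv_into_into f_inv_into_f)
    then have "word_prod letter (inv_into W \<psi> (\<psi> w)) = g"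
      using determined w by blast
    then show "g \<in> (\<lambda>f. word_prod letter (inv_into W \<psi> f)) ` (\<psi> ` W)" using w(1) by blast
  qed
  then have "card (word_prod letter ` W) \<le> card (\<psi> ` W)"
    using finW by (meson card_image_le card_mono finite_imageI order_trans)
  also have "\<dots> \<le> card (V \<rightarrow>\<^sub>E {- int R..int R})"
  proof (rule card_mono)
    show "finite (V \<rightarrow>\<^sub>E {- int R..int R})" using finV by (intro finite_PiE) auto
    have "\<bar>lazy_walk (orbit_step (rep v)) w\<bar> \<le> int R" if "w \<in> W" "v \<in> V" for w v
      using stays_within_endpoint[OF stays] that by (simp add: V_def N_def)
    then show "\<psi> ` W \<subseteq> V \<rightarrow>\<^sub>E {- int R..int R}"
      by (auto simp: \<psi>_def abs_le_iff) (metis minus_le_iff)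
  qed
  also have "\<dots> = (2 * R + 1) ^ card V"
  proof -
    have "card {- int R..int R} = 2 * R + 1" by (simp add: nat_eq_iff)
    then show ?thesis using finV by (simp only: card_funcsetE)
  qed
  finally show ?thesis by (simp add: V_def complexity_def N_def)
qed

text \<open>
  The exponential bound for the nearly optimal weight \<open>\<beta> = R / (2 * D\<^sup>2 * n)\<close>; the hypothesis on \<open>R\<close>
  keeps \<open>\<beta> * D\<close> in the range where \<open>cosh t \<le> exp (t\<^sup>2)\<close> is available.
\<close>

lemma orbit_tail:
  assumes x: "x \<in> X" "\<not> periodic_point x" and n: "n > 0" "R \<le> 2 * D * n" and i: "i \<le> n"
  shows "real (card {w \<in> words J i. \<bar>lazy_walk (orbit_step x) w\<bar> > int R})
    \<le> real (2 * n * D + 1) * exp (- ((real R)\<^sup>2 / (4 * (real D)\<^sup>2 * real n))) * real (card J) ^ i"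
proof -
  define \<beta> where "\<beta> = real R / (2 * (real D)\<^sup>2 * real n)"
  have \<beta>: "\<beta> \<ge> 0" by (simp add: \<beta>_def)
  have "real R \<le> 2 * real D * real n"
    using n(2) by (metis of_nat_le_iff of_nat_mult of_nat_numeral)
  then have \<beta>D: "\<bar>\<beta> * D\<bar> \<le> 1"
    using n(1) D_pos by (simp add: \<beta>_def power2_eq_square field_simps)
  have "cosh (\<beta> * D) ^ i \<le> cosh (\<beta> * D) ^ n"
    using i by (intro power_increasing) (auto simp: cosh_real_ge_1)
  also have "\<dots> \<le> exp ((\<beta> * D)\<^sup>2) ^ n"
    using cosh_le_exp_square[OF \<beta>D] by (intro power_mono) auto
  also have "\<dots> = exp (real n * (\<beta> * D)\<^sup>2)"
    by (simp add: exp_of_nat_mult)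
  finally have cosh: "cosh (\<beta> * D) ^ i \<le> exp (real n * (\<beta> * D)\<^sup>2)" .
  have "- \<beta> * R + real n * (\<beta> * D)\<^sup>2 = - ((real R)\<^sup>2 / (4 * (real D)\<^sup>2 * real n))"
    using n(1) D_pos by (simp add: \<beta>_def power2_eq_square field_simps)
  then have "exp (- \<beta> * R) * exp (real n * (\<beta> * D)\<^sup>2) = exp (- ((real R)\<^sup>2 / (4 * (real D)\<^sup>2 * real n)))"
    by (simp only: flip: exp_add)
  then have E: "exp (- \<beta> * R) * cosh (\<beta> * D) ^ i \<le> exp (- ((real R)\<^sup>2 / (4 * (real D)\<^sup>2 * real n)))"
    using cosh by (metis mult_left_mono exp_ge_zero)
  have "real (card {w \<in> words J i. \<bar>lazy_walk (orbit_step x) w\<bar> > int R})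
      \<le> real (2 * i * D + 1) * (exp (- \<beta> * R) * cosh (\<beta> * D) ^ i) * real (card J) ^ i"
  proof (rule lazy_walk_tail[where \<iota> = "\<lambda>g. inv\<^bsub>G\<^esub> g"])
    show "\<bar>orbit_step x g p - p\<bar> \<le> int D" if "g \<in> K" for g p
      using bound[OF that shift_power_in_subshift[OF sub x(1)]] by (simp add: orbit_step_def)
  qed (use K K_inv orbit_step_inv[OF x] \<beta> in auto)
  also have "\<dots> \<le> real (2 * n * D + 1) * exp (- ((real R)\<^sup>2 / (4 * (real D)\<^sup>2 * real n))) * real (card J) ^ i"
    using E i by (intro mult_right_mono mult_mono of_nat_mono) (auto simp: cosh_real_pos less_imp_le)
  finally show ?thesis .
qed

text \<open>
  Every window occurs at an aperiodic point, and the Gaussian bound holds on its orbit. By the union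
  bound over all windows at least half of the words keep all these orbits confined.
\<close>

lemma word_products_concentrate:
  assumes n: "n > 0" "R \<le> 2 * D * n"
    and small: "2 * real n * real (2 * n * D + 1) * exp (- ((real R)\<^sup>2 / (4 * (real D)\<^sup>2 * real n)))
      * real (complexity X (2 * (R + m) + 1)) \<le> 1"
  shows "\<exists>W \<subseteq> words J n. card J ^ n \<le> 2 * card W \<and>
    card (word_prod letter ` W) \<le> (2 * R + 1) ^ complexity X (2 * (R + m) + 1)"
proof -
  define N where "N = 2 * (R + m) + 1"
  define V where "V = subshift_words X N"
  define \<tau> where "\<tau> = real (2 * n * D + 1) * exp (- ((real R)\<^sup>2 / (4 * (real D)\<^sup>2 * real n)))"
  have finV: "finite V" unfolding V_def using sub by (rule finite_subshift_words)
  have "\<exists>y. y \<in> X \<and> \<not> periodic_point y \<and> (\<forall>i<N. y (int i - int (R + m)) = v ! i)" if v: "v \<in> V" for v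
  proof -
    obtain x i where x: "x \<in> X" "\<forall>j<N. v ! j = x (i + int j)"
      using v by (auto simp: V_def subshift_words_def)
    let ?x = "shift_power (i + int (R + m)) x"
    obtain y where y: "y \<in> X" "\<not> periodic_point y" "\<And>l. \<bar>l\<bar> \<le> int (R + m) \<Longrightarrow> y l = ?x l"
      using aperiodic_point_in_cylinder[OF sub iso shift_power_in_subshift[OF sub x(1)]] by metis
    have "y (int j - int (R + m)) = v ! j" if "j < N" for j
      using y(3)[of "int j - int (R + m)"] x(2) that by (auto simp: N_def shift_power_apply algebra_simps)
    then show ?thesis using y by blast
  qed
  then obtain rep where rep: "\<And>v. v \<in> V \<Longrightarrow> rep v \<in> X" "\<And>v. v \<in> V \<Longrightarrow> \<not> periodic_point (rep v)"
      "\<And>v i. v \<in> V \<Longrightarrow> i < N \<Longrightarrow> rep v (int i - int (R + m)) = v ! i"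
    by metis
  define bad where "bad v = {w \<in> words J n. \<not> stays_within R (orbit_step (rep v)) w}" for v
  define W where "W = words J n - (\<Union>v\<in>V. bad v)"
  have fin: "finite (words J n)" by (intro finite_words finite_J)
  have bad: "real (card (bad v)) \<le> real n * \<tau> * real (card J) ^ n" if "v \<in> V" for v
    unfolding bad_def \<tau>_def
    using orbit_tail[OF rep(1,2)[OF that] n] K(1) by (intro card_not_stays_within) auto
  have "card (words J n) \<le> card (W \<union> (\<Union>v\<in>V. bad v))"
    using fin finV by (intro card_mono) (auto simp: W_def bad_def)
  also have "\<dots> \<le> card W + card (\<Union>v\<in>V. bad v)" by (rule card_Un_le)
  also have "\<dots> \<le> card W + (\<Sum>v\<in>V. card (bad v))"
    using card_UN_le[OF finV] by simp
  finally have "real (card J) ^ n \<le> real (card W) + (\<Sum>v\<in>V. real (card (bad v)))"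
    by (simp add: card_words[OF finite_J] flip: of_nat_power of_nat_add of_nat_sum)
  also have "\<dots> \<le> real (card W) + (\<Sum>v\<in>V. real n * \<tau> * real (card J) ^ n)"
    by (intro add_left_mono sum_mono bad)
  also have "\<dots> = real (card W) + (real n * \<tau> * real (complexity X N)) * real (card J) ^ n"
    by (simp add: V_def complexity_def)
  also have "\<dots> \<le> real (card W) + 1 / 2 * real (card J) ^ n"
  proof -
    have "2 * (real n * \<tau> * real (complexity X N)) \<le> 1"
      using small by (simp only: \<tau>_def N_def mult.assoc)
    then show ?thesis by (intro add_left_mono mult_right_mono) auto
  qed
  finally have "real (card J ^ n) \<le> real (2 * card W)" by simp
  then have "card J ^ n \<le> 2 * card W" by (simp only: of_nat_le_iff)
  moreover have "card (word_prod letter ` W) \<le> (2 * R + 1) ^ complexity X (2 * (R + m) + 1)"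
  proof (rule few_word_products_with_confined_orbits)
    show "rep v \<in> X \<and> (\<forall>i < 2 * (R + m) + 1. rep v (int i - int (R + m)) = v ! i)"
      if "v \<in> subshift_words X (2 * (R + m) + 1)" for v
      using rep(1,3)[of v] that by (simp add: V_def N_def)
    show "W \<subseteq> words J n" by (auto simp: W_def)
    show "stays_within R (orbit_step (rep v)) w"
      if "w \<in> W" "v \<in> subshift_words X (2 * (R + m) + 1)" for w v
      using that by (auto simp: W_def bad_def V_def N_def)
  qed
  ultimately show ?thesis using W_def by blast
qed

end

lemma full_group_words_exist:
  fixes A X
  defines "G \<equiv> topological_full_group A X"
  assumes sub: "subshift A X" and iso: "without_isolated_periodic_points A X"
    and K: "finite K" "K \<subseteq> carrier G" "\<And>g. g \<in> K \<Longrightarrow> inv\<^bsub>G\<^esub> g \<in> K"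
  shows "\<exists>\<kappa> m D. full_group_words A X K \<kappa> m D"
proof -
  have "\<exists>k m D. (\<forall>x\<in>X. g x = shift_power (k x) x) \<and>
      (\<forall>x\<in>X. \<forall>y\<in>X. (\<forall>i. \<bar>i\<bar> \<le> int m \<longrightarrow> x i = y i) \<longrightarrow> k x = k y) \<and> (\<forall>x\<in>X. \<bar>k x\<bar> \<le> int D)"
    if "g \<in> K" for g
  proof -
    have "g \<in> full_group_elements A X"
      using that K(2) by (auto simp: G_def topological_full_group_def)
    then obtain k where k: "continuous_map (subshift_topology A X) (discrete_topology UNIV) k"
        "\<forall>x\<in>X. g x = shift_power (k x) x"
      by (auto simp: full_group_elements_def)
    obtain m D where "\<And>x y. x \<in> X \<Longrightarrow> y \<in> X \<Longrightarrow> (\<forall>i. \<bar>i\<bar> \<le> int m \<longrightarrow> x i = y i) \<Longrightarrow> k x = k y"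
        "\<And>x. x \<in> X \<Longrightarrow> \<bar>k x\<bar> \<le> int D"
      using continuous_integer_function_window[OF sub k(1)] by metis
    then show ?thesis using k(2) by blast
  qed
  then obtain \<kappa> M B where \<kappa>: "\<And>g x. g \<in> K \<Longrightarrow> x \<in> X \<Longrightarrow> g x = shift_power (\<kappa> g x) x"
    and M: "\<And>g x y. g \<in> K \<Longrightarrow> x \<in> X \<Longrightarrow> y \<in> X \<Longrightarrow> (\<forall>i. \<bar>i\<bar> \<le> int (M g) \<longrightarrow> x i = y i) \<Longrightarrow> \<kappa> g x = \<kappa> g y"
    and B: "\<And>g x. g \<in> K \<Longrightarrow> x \<in> X \<Longrightarrow> \<bar>\<kappa> g x\<bar> \<le> int (B g)"
    by metis
  define m where "m = Max (insert 0 (M ` K))"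
  define D where "D = Max (insert 1 (B ` K))"
  have m: "M g \<le> m" and D: "B g \<le> D" if "g \<in> K" for g
    using K(1) that by (auto simp: m_def D_def)
  have "full_group_words A X K \<kappa> m D"
  proof (rule full_group_words.intro)
    fix g x assume g: "g \<in> K" and x: "x \<in> X"
    show "\<bar>\<kappa> g x\<bar> \<le> int D" using B[OF g x] D[OF g] by linarith
    fix y assume "y \<in> X" "\<forall>i. \<bar>i\<bar> \<le> int m \<longrightarrow> x i = y i"
    then show "\<kappa> g x = \<kappa> g y" using M[OF g x] m[OF g] by auto
  next
    have "1 \<le> D" using K(1) by (auto simp: D_def)
    then show "D > 0" by simp
  qed (use sub iso K in \<open>simp_all add: G_def \<kappa>\<close>)
  then show ?thesis by blast
qed

theorem corollary1p5:
  fixes A :: "'a set" and X :: "(int \<Rightarrow> 'a) set"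
  assumes "subshift A X"
    and "without_isolated_periodic_points A X"
    and "(\<lambda>n::nat. (ln (real n) / real n)\<^sup>2 * real (complexity X n)) \<longlonglongrightarrow> 0"
  shows "amenable_group (topological_full_group A X)"
proof (rule amenable_if_almost_invariant[OF group_topological_full_group[OF assms(1)]])
  let ?G = "topological_full_group A X"
  interpret group ?G using assms(1) by (rule group_topological_full_group)
  fix K0 \<epsilon> assume K0: "finite K0" "K0 \<subseteq> carrier ?G" and \<epsilon>: "(\<epsilon>::real) > 0"
  define K where "K = insert \<one>\<^bsub>?G\<^esub> (K0 \<union> (\<lambda>g. inv\<^bsub>?G\<^esub> g) ` K0)"
  have K: "finite K" "K \<subseteq> carrier ?G" "\<And>g. g \<in> K \<Longrightarrow> inv\<^bsub>?G\<^esub> g \<in> K"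
    using K0 by (auto simp: K_def)
  obtain \<kappa> m D where "full_group_words A X K \<kappa> m D"
    using full_group_words_exist[OF assms(1,2) K] by blast
  then interpret full_group_words A X K \<kappa> m D .
  have "\<exists>\<mu>. finitely_additive_prob (carrier ?G) \<mu> \<and> (\<forall>j\<in>J. almost_invariant ?G (letter j) \<epsilon> \<mu>)"
  proof (rule almost_invariant_if_word_products_concentrate[where e = "(False, \<one>\<^bsub>?G\<^esub>)"])
    fix c :: real assume "c > 0"
    obtain n R where n: "n > 0" "R \<le> 2 * D * n"
      "2 * real n * real (2 * n * D + 1) * exp (- ((real R)\<^sup>2 / (4 * (real D)\<^sup>2 * real n)))
        * real (complexity X (2 * (R + m) + 1)) \<le> 1"
      and c: "4 * real (2 * R + 1) ^ complexity X (2 * (R + m) + 1) < exp (c * real n)"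
      by (rule time_and_radius_exist[OF assms(3) D_pos \<open>c > 0\<close>])
    obtain W where W: "W \<subseteq> words J n" "card J ^ n \<le> 2 * card W"
      "card (word_prod letter ` W) \<le> (2 * R + 1) ^ complexity X (2 * (R + m) + 1)"
      using word_products_concentrate[OF n] by blast
    have "4 * real (card (word_prod letter ` W)) \<le> 4 * real (2 * R + 1) ^ complexity X (2 * (R + m) + 1)"
      using W(3) by (simp only: flip: of_nat_power)
    then show "\<exists>n W. W \<subseteq> words J n \<and> card J ^ n \<le> 2 * card W \<and>
        4 * real (card (word_prod letter ` W)) < exp (c * real n)"
      using W(1,2) c by (meson le_less_trans)
  qed (use \<epsilon> finite_J letter_closed in \<open>auto simp: K_def letter_def\<close>)
  then obtain \<mu> where \<mu>: "finitely_additive_prob (carrier ?G) \<mu>"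
      "\<And>j. j \<in> J \<Longrightarrow> almost_invariant ?G (letter j) \<epsilon> \<mu>" by blast
  have "almost_invariant ?G g \<epsilon> \<mu>" if "g \<in> K0" for g
    using \<mu>(2)[of "(True, g)"] that by (simp add: K_def letter_def)
  then show "\<exists>\<mu>. finitely_additive_prob (carrier ?G) \<mu> \<and> (\<forall>g\<in>K0. almost_invariant ?G g \<epsilon> \<mu>)"
    using \<mu>(1) by blast
qed

end
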